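(* Let $G$ be a compact group with $G\neq\{e\}$, let $\mu=(\mu_k)_{k\in-\mathbf N}$ be a sequence of Borel probability measures on $G$, and let $\mathbf P^o\in\mathrm{ex}(\mathcal P_\mu)$ be a fixed extremal point. Then the action of $(T_g: g\in G)$ restricted to $\mathrm{ex}(\mathcal P_\mu)$ induces a homeomorphism $$G/H_\mu(\mathbf P^o)\xrightarrow{\ \sim\ }\mathrm{ex}(\mathcal P_\mu)$$ (given by $gH_\mu(\mathbf P^o)\mapsto T_g(\mathbf P^o)$).
   Context: $-\mathbf N=\{0,-1,-2,\dots\}$; $e$ is the unit of $G$. On $G^{-\mathbf N}$ let $\eta=(\eta_k)_{k\in-\mathbf N}$ be the coordinate process, and set $\xi_k=(\eta_{k-1})^{-1}\cdot\eta_k$ for $k\in-\mathbf N$. Let $\mathcal F^\eta_k=\sigma(\eta_k,\eta_{k-1},\dots)$. A solution (of $\eta_k=\eta_{k-1}\cdot\xi_k$, $k\in-\mathbf N$, with noise law $\mu$) is a probability measure $\mathbf P$ on $G^{-\mathbf N}$ such that, for every $k\in-\mathbf N$, under $\mathbf P$: (i) $\xi_k$ is independent of $\mathcal F^\eta_{k-1}$; (ii) $\xi_k$ has law $\mu_k$. The set of all solutions is $\mathcal P_\mu$; it is a closed convex subset of the space of signed measures on $G^{-\mathbf N}$ with the weak-star topology (duality with continuous functions), and $\mathrm{ex}(\mathcal P_\mu)$ is its set of extremal points, with the induced topology. For $g\in G$ and $\mathbf P\in\mathcal P_\mu$, $T_g(\mathbf P)(\cdot)=\mathbf P(g\cdot\eta\in\cdot)$,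 where $g\cdot\eta=(g\cdot\eta_k)_{k\in-\mathbf N}$; this is a group action of $G$ on $\mathcal P_\mu$ leaving $\mathrm{ex}(\mathcal P_\mu)$ invariant. $H_\mu(\mathbf P^o)=\{g\in G: T_g(\mathbf P^o)=\mathbf P^o\}$ is the isotropic subgroup at $\mathbf P^o$, a closed subgroup of $G$, and $G/H_\mu(\mathbf P^o)$ carries the quotient topology. *)

theory Defs
  imports "HOL-Probability.Probability" "HOL-Library.Set_Algebras"
begin

text \<open>
  The group is a type of class \<open>topological_group_add\<close>. That class does not assume
  commutativity: the product \<open>g \<cdot> h\<close> is written \<open>g + h\<close>, the inverse \<open>- g\<close> and the unit \<open>0\<close>.

  The nonpositive integers are indexed by \<open>nat\<close>: the coordinate \<open>x n\<close> of a path
  \<open>x :: nat \<Rightarrow> 'a\<close> stands for \<open>\<eta>\<^sub>k\<close> with \<open>k = -n\<close>, so that \<open>\<eta>\<^bsub>k-1\<^esub>\<close> is \<open>x (Suc n)\<close>.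
  Path space carries the product topology and its Borel sigma-algebra.
\<close>

text \<open>
  Under the duality with continuous functions on a compact Hausdorff space, the measures are
  the regular Borel ones. On compact metrizable spaces regularity is automatic (see
  \<open>regular_prob_polish\<close>); without it, neither would a measure be determined by the integrals
  of continuous functions, nor would the weak-star topology be Hausdorff.
\<close>

definition regular_prob :: "'b::topological_space measure \<Rightarrow> bool" where
  "regular_prob M \<longleftrightarrow> prob_space M \<and> sets M = sets borel \<and>
    (\<forall>A\<in>sets borel. emeasure M A = (SUP K\<in>{K. K \<subseteq> A \<and> compact K}. emeasure M K))"

lemma regular_prob_polish:
  fixes M :: "'b::polish_space measure"
  assumes "prob_space M" "sets M = sets borel"
  shows "regular_prob M"
proof -
  interpret prob_space M by fact
  have "emeasure M A = (SUP K\<in>{K. K \<subseteq> A \<and> compact K}. emeasure M K)" if "A \<in> sets borel" for A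
    by (rule inner_regular) (use assms(2) that in \<open>auto simp: emeasure_eq_measure\<close>)
  then show ?thesis
    using assms by (simp add: regular_prob_def)
qed

text \<open>
  Only the trace on the regular probability measures (its \<open>topspace\<close>) of the weak-star
  topology on signed measures is needed. All spaces below are compact, so the test functions
  need not be assumed bounded.
\<close>

definition weak_star_topology :: "'b::topological_space measure topology" where
  "weak_star_topology = topology_generated_by
    {{M. regular_prob M \<and> (\<integral>x. f x \<partial>M) \<in> U} | (f :: 'b \<Rightarrow> real) U.
      continuous_on UNIV f \<and> open U}"

lemma topspace_weak_star_topology: "topspace weak_star_topology = Collect regular_prob"
  unfolding weak_star_topology_def topology_generated_by_topspace
  by (force intro!: exI[of _ "\<lambda>_. 0"] exI[of _ UNIV])

definition noise :: "nat \<Rightarrow> (nat \<Rightarrow> 'a::group_add) \<Rightarrow> 'a" where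
  "noise n x = - x (Suc n) + x n"

definition past :: "nat \<Rightarrow> (nat \<Rightarrow> 'a::topological_space) set set" where
  "past n = sigma_sets UNIV {(\<lambda>x. x m) -` A | m A. n \<le> m \<and> A \<in> sets borel}"

definition solutions ::
    "(nat \<Rightarrow> 'a::topological_group_add measure) \<Rightarrow> (nat \<Rightarrow> 'a) measure set" where
  "solutions \<mu> = {P. regular_prob P \<and>
    (\<forall>n. prob_space.indep_set P {noise n -` A | A. A \<in> sets borel} (past (Suc n)) \<and>
         distr P borel (noise n) = \<mu> n)}"

text \<open>
  The condition \<open>extreme_point_of\<close> written out for measures, which do not form an instance
  of class \<open>real_vector\<close>.
\<close>

definition extremal_solutions ::
    "(nat \<Rightarrow> 'a::topological_group_add measure) \<Rightarrow> (nat \<Rightarrow> 'a) measure set" where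
  "extremal_solutions \<mu> = {P \<in> solutions \<mu>.
    \<forall>Q\<in>solutions \<mu>. \<forall>R\<in>solutions \<mu>. \<not> (Q \<noteq> R \<and> (\<exists>t. 0 < t \<and> t < 1 \<and>
      (\<forall>A\<in>sets borel. measure P A = (1 - t) * measure Q A + t * measure R A)))}"

definition translate ::
    "'a::topological_group_add \<Rightarrow> (nat \<Rightarrow> 'a) measure \<Rightarrow> (nat \<Rightarrow> 'a) measure" where
  "translate g P = distr P borel (\<lambda>x n. g + x n)"

definition isotropy :: "(nat \<Rightarrow> 'a::topological_group_add) measure \<Rightarrow> 'a set" where
  "isotropy P = {g. translate g P = P}"

definition coset_topology :: "'a::topological_group_add set \<Rightarrow> 'a set topology" where
  "coset_topology H =
    topology (\<lambda>W. W \<subseteq> range (\<lambda>g. g +o H) \<and> open ((\<lambda>g. g +o H) -` W))"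

lemma openin_coset_topology:
  "openin (coset_topology H) W \<longleftrightarrow> W \<subseteq> range (\<lambda>g. g +o H) \<and> open ((\<lambda>g. g +o H) -` W)"
proof -
  have "istopology (\<lambda>W. W \<subseteq> range (\<lambda>g. g +o H) \<and> open ((\<lambda>g. g +o H) -` W))"
    unfolding istopology_def by (auto simp: vimage_Int vimage_Union intro!: open_Int open_UN)
  then show ?thesis
    by (simp add: coset_topology_def)
qed

lemma topspace_coset_topology: "topspace (coset_topology H) = range (\<lambda>g. g +o H)"
proof (rule subset_antisym)
  show "topspace (coset_topology H) \<subseteq> range (\<lambda>g. g +o H)"
    using openin_topspace[of "coset_topology H"] by (simp only: openin_coset_topology)
  have "(\<lambda>g. g +o H) -` range (\<lambda>g. g +o H) = UNIV"
    by auto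
  then show "range (\<lambda>g. g +o H) \<subseteq> topspace (coset_topology H)"
    by (intro openin_subset) (simp add: openin_coset_topology)
qed

lemma quotient_map_coset_topology: "quotient_map euclidean (coset_topology H) (\<lambda>g. g +o H)"
  by (auto simp: quotient_map_def topspace_coset_topology openin_coset_topology vimage_def)

end

theory Submission
  imports Defs
begin

text \<open>
  Two extremal solutions differ by a translation. Once this is known, the extremal solutions form
  a single orbit, the orbit map induces a continuous bijection from the compact space of cosets
  of the isotropy group onto a Hausdorff space, and such a map is a homeomorphism.

  The idea behind transitivity is to drive two solutions by the same noise. If
  \<open>\<eta>\<^sub>k = \<eta>\<^bsub>k-1\<^esub> \<cdot> \<xi>\<^sub>k\<close> and \<open>\<eta>'\<^sub>k = \<eta>'\<^bsub>k-1\<^esub> \<cdot> \<xi>\<^sub>k\<close> with one and the same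
  \<open>\<xi>\<close>, then the ratio \<open>\<eta>\<^sub>k \<cdot> \<eta>'\<^sub>k\<^sup>-\<^sup>1\<close> does not depend on \<open>k\<close>. So it is determined by the
  arbitrarily remote past, and extremality makes the remote past of each of the two solutions
  irrelevant: conditioning on the ratio being close to some value \<open>z\<close> changes neither the law of
  \<open>\<eta>\<close> nor that of \<open>\<eta>'\<close>. But under this condition \<open>\<eta>\<close> is close to \<open>z \<cdot> \<eta>'\<close>. Hence the
  two laws are translates of each other by any \<open>z\<close> in the support of the law of the ratio.

  The group need not be metrizable, so neither the law of the coupled pair nor a limit of such
  laws is constructed. Instead, the coupling is started at time \<open>-k\<close> from independent
  states, and it enters only through iterated integrals of continuous functions:
  \<open>resample\<close> is the conditional expectation of a function of the path given the
  past up to time \<open>-k\<close>, obtained by integrating out the later noise (\<open>integral_resample\<close>),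
  and because the noise is multiplied from the right it respects translations, so that it compares
  the two solutions (\<open>common_noise_estimate\<close>).
  That extremality makes the remote past irrelevant is \<open>extremal_remote_past_mixing\<close>: weights
  that depend only on the past up to time \<open>-k\<close> become uncorrelated with every integrable function
  as \<open>k\<close> grows. Otherwise a limit of these weights would decompose the solution into two
  different ones. The limit is taken setwise along a filter given by Tychonoff's theorem;
  it is dominated by the original solution, and therefore countably additive and regular.
\<close>

section \<open>Path space\<close>

lemma open_vimage_coordinate:
  "open W \<Longrightarrow> open ((\<lambda>z :: 'i \<Rightarrow> 'b::topological_space. z i) -` W)"
  by (rule open_vimage) simp_all

text \<open>
  Products of Hausdorff spaces are Hausdorff. The weaker separation classes come first because
  the instances for metric spaces already provide their arities, and the instance for
  \<^class>\<open>t2_space\<close> has to be no more general than these.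
\<close>

instance "fun" :: (type, t0_space) t0_space
proof
  fix x y :: "'a \<Rightarrow> 'b"
  assume "x \<noteq> y"
  then obtain i where "x i \<noteq> y i"
    by blast
  then obtain U where "open U" "(x i \<in> U) \<noteq> (y i \<in> U)"
    using t0_space_class.t0_space[OF \<open>x i \<noteq> y i\<close>] by blast
  then have "open ((\<lambda>z. z i) -` U) \<and> \<not> (x \<in> (\<lambda>z. z i) -` U \<longleftrightarrow> y \<in> (\<lambda>z. z i) -` U)"
    by (simp add: open_vimage_coordinate)
  then show "\<exists>U. open U \<and> \<not> (x \<in> U \<longleftrightarrow> y \<in> U)" ..
qed

instance "fun" :: (type, t1_space) t1_space
proof
  fix x y :: "'a \<Rightarrow> 'b"
  assume "x \<noteq> y"
  then obtain i where "x i \<noteq> y i"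
    by blast
  then obtain U where "open U" "x i \<in> U" "y i \<notin> U"
    using t1_space[OF \<open>x i \<noteq> y i\<close>] by blast
  then have "open ((\<lambda>z. z i) -` U) \<and> x \<in> (\<lambda>z. z i) -` U \<and> y \<notin> (\<lambda>z. z i) -` U"
    by (simp add: open_vimage_coordinate)
  then show "\<exists>U. open U \<and> x \<in> U \<and> y \<notin> U" ..
qed

instance "fun" :: (type, t2_space) t2_space
proof
  fix x y :: "'a \<Rightarrow> 'b"
  assume "x \<noteq> y"
  then obtain i where "x i \<noteq> y i"
    by blast
  then obtain U V where UV: "open U" "open V" "x i \<in> U" "y i \<in> V" "U \<inter> V = {}"
    using hausdorff[OF \<open>x i \<noteq> y i\<close>] by blast
  then have "open ((\<lambda>z. z i) -` U) \<and> open ((\<lambda>z. z i) -` V) \<and> x \<in> (\<lambda>z. z i) -` U \<and>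
      y \<in> (\<lambda>z. z i) -` V \<and> (\<lambda>z. z i) -` U \<inter> (\<lambda>z. z i) -` V = {}"
    by (simp add: open_vimage_coordinate flip: vimage_Int)
  then show "\<exists>U V. open U \<and> open V \<and> x \<in> U \<and> y \<in> V \<and> U \<inter> V = {}"
    by blast
qed

lemma compact_UNIV_fun:
  assumes "compact (UNIV :: 'b::topological_space set)"
  shows "compact (UNIV :: ('i \<Rightarrow> 'b) set)"
proof -
  have "compact_space (euclidean :: 'b topology)"
    using assms by (simp add: compact_space_def)
  then have "compact_space (product_topology (\<lambda>_::'i. euclidean :: 'b topology) UNIV)"
    by (simp add: compact_space_product_topology)
  then have "compact_space (euclidean :: ('i \<Rightarrow> 'b) topology)"
    by (simp only: euclidean_product_topology)
  then show ?thesis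
    by (simp add: compact_space_def)
qed

section \<open>Continuous functions on compact Hausdorff spaces\<close>

lemma Urysohn_compact:
  fixes S T :: "'b::t2_space set"
  assumes "compact (UNIV :: 'b set)" "closed S" "closed T" "S \<inter> T = {}"
  obtains f :: "'b \<Rightarrow> real" where "continuous_on UNIV f" "range f \<subseteq> {0..1}"
    "\<And>x. x \<in> S \<Longrightarrow> f x = 0" "\<And>x. x \<in> T \<Longrightarrow> f x = 1"
proof -
  have "Hausdorff_space (euclidean :: 'b topology)"
    unfolding Hausdorff_space_def disjnt_def using hausdorff by auto
  then have "normal_space (euclidean :: 'b topology)"
    using assms(1) by (intro compact_Hausdorff_or_regular_imp_normal_space)
      (auto simp: compact_space_def)
  moreover have "disjnt S T"
    using assms(4) by (simp add: disjnt_def)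
  ultimately obtain f where f: "continuous_map euclidean (top_of_set {0..1::real}) f"
      "f ` S \<subseteq> {0}" "f ` T \<subseteq> {1}"
    using assms(2,3) Urysohn_lemma[of euclidean S T 0 1] by auto
  show thesis
    by (rule that[of f]) (use f in \<open>auto simp: continuous_map_in_subtopology\<close>)
qed

lemma separate_points:
  fixes x y :: "'b::t2_space"
  assumes "compact (UNIV :: 'b set)" "x \<noteq> y"
  obtains f :: "'b \<Rightarrow> real" where "continuous_on UNIV f" "f x \<noteq> f y"
proof -
  obtain f :: "'b \<Rightarrow> real" where "continuous_on UNIV f"
    "\<And>z. z \<in> {x} \<Longrightarrow> f z = 0" "\<And>z. z \<in> {y} \<Longrightarrow> f z = 1"
    by (rule Urysohn_compact[of "{x}" "{y}"]) (use assms in auto)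
  then show thesis
    using that[of f] by simp
qed

text \<open>
  A continuous function of two variables varies uniformly little over a compact second variable;
  this is the tube lemma.
\<close>

lemma uniform_in_compact_parameter:
  fixes F :: "'b::topological_space \<Rightarrow> 'c::topological_space \<Rightarrow> real"
  assumes "compact (UNIV :: 'c set)" "continuous_on UNIV (\<lambda>(x, y). F x y)" "0 < e"
  obtains A where "open A" "z \<in> A" "\<And>x y. x \<in> A \<Longrightarrow> \<bar>F x y - F z y\<bar> \<le> e"
proof -
  obtain A where "z \<in> A" "open A" "\<forall>x\<in>A \<inter> UNIV. \<forall>y\<in>UNIV. dist (F x y) (F z y) \<le> e"
    using continuous_on_prod_compactE[of UNIV UNIV "\<lambda>(x, y). F x y" z e] assms by auto
  with that show thesis
    by (auto simp: dist_real_def)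
qed

text \<open>
  The functions of finitely many coordinates form an algebra that separates paths, so the
  Stone-Weierstrass theorem gives a uniform approximation by one of them.
\<close>

lemma continuous_depends_on_finitely_many:
  fixes f :: "(nat \<Rightarrow> 'a::t2_space) \<Rightarrow> real"
  assumes cpt: "compact (UNIV :: 'a set)" and f: "continuous_on UNIV f" and "0 < e"
  obtains n where "\<And>x y. (\<And>j. j \<le> n \<Longrightarrow> x j = y j) \<Longrightarrow> \<bar>f x - f y\<bar> \<le> e"
proof -
  define R where "R = {f :: (nat \<Rightarrow> 'a) \<Rightarrow> real. continuous_on UNIV f \<and>
    (\<exists>n. \<forall>x y. (\<forall>j\<le>n. x j = y j) \<longrightarrow> f x = f y)}"
  interpret function_ring_on R UNIV
  proof
    show "compact (UNIV :: (nat \<Rightarrow> 'a) set)"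
      by (rule compact_UNIV_fun) fact
    show "(\<lambda>x. f x + g x) \<in> R" "(\<lambda>x. f x * g x) \<in> R" if fg: "f \<in> R" "g \<in> R" for f g
    proof -
      have cont: "continuous_on UNIV f" "continuous_on UNIV g"
        using fg by (simp_all add: R_def)
      from fg obtain m n where "\<forall>x y. (\<forall>j\<le>m. x j = y j) \<longrightarrow> f x = f y"
        "\<forall>x y. (\<forall>j\<le>n. x j = y j) \<longrightarrow> g x = g y"
        unfolding R_def mem_Collect_eq by (elim conjE exE)
      then have fg_eq: "f x = f y \<and> g x = g y" if "\<forall>j\<le>max m n. x j = y j" for x y
        using that by simp
      have s1: "\<forall>x y. (\<forall>j\<le>max m n. x j = y j) \<longrightarrow> f x + g x = f y + g y"
        and s2: "\<forall>x y. (\<forall>j\<le>max m n. x j = y j) \<longrightarrow> f x * g x = f y * g y"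
        using fg_eq by metis+
      show "(\<lambda>x. f x + g x) \<in> R"
        unfolding R_def mem_Collect_eq by (intro conjI continuous_on_add cont exI) (rule s1)
      show "(\<lambda>x. f x * g x) \<in> R"
        unfolding R_def mem_Collect_eq by (intro conjI continuous_on_mult cont exI) (rule s2)
    qed
    fix x y :: "nat \<Rightarrow> 'a" assume "x \<noteq> y"
    then obtain i where "x i \<noteq> y i" by blast
    from separate_points[OF cpt this]
    obtain u :: "'a \<Rightarrow> real" where u: "continuous_on UNIV u" "u (x i) \<noteq> u (y i)" .
    have "continuous_on UNIV (\<lambda>z :: nat \<Rightarrow> 'a. u (z i))"
      by (rule continuous_on_compose2[OF u(1) continuous_on_product_coordinates]) simp
    then have "(\<lambda>z. u (z i)) \<in> R"
      unfolding R_def by (auto intro!: exI[of _ i])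
    then show "\<exists>f\<in>R. f x \<noteq> f y"
      by (rule rev_bexI) (rule u(2))
  qed (auto simp: R_def)
  obtain g where g: "g \<in> R" "\<And>x. \<bar>f x - g x\<bar> < e / 2"
    using Stone_Weierstrass_basic[OF f, of "e / 2"] \<open>0 < e\<close> by auto
  obtain n where n: "\<And>x y. (\<And>j. j \<le> n \<Longrightarrow> x j = y j) \<Longrightarrow> g x = g y"
    using g(1) unfolding R_def by blast
  show thesis
  proof (rule that[of n])
    fix x y :: "nat \<Rightarrow> 'a" assume "\<And>j. j \<le> n \<Longrightarrow> x j = y j"
    then have "g x = g y" by (rule n)
    then show "\<bar>f x - f y\<bar> \<le> e"
      using g(2)[of x] g(2)[of y] by linarith
  qed
qed

section \<open>Integrals of continuous functions\<close>

lemma continuous_integrable: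
  fixes f :: "'b::topological_space \<Rightarrow> real"
  assumes "compact (UNIV :: 'b set)" "continuous_on UNIV f" "finite_measure M" "sets M = sets borel"
  shows "integrable M f"
proof -
  interpret finite_measure M by fact
  have "bounded (range f)"
    using assms by (intro compact_imp_bounded compact_continuous_image)
  then obtain B where "\<And>x. norm (f x) \<le> B"
    by (auto simp: bounded_iff)
  moreover have "f \<in> borel_measurable M"
    using borel_measurable_continuous_onI[OF assms(2)] assms(4) by (simp cong: measurable_cong_sets)
  ultimately show ?thesis
    by (intro integrable_const_bound[where B = B]) auto
qed

lemma continuous_on_integral_parameter:
  fixes F :: "'b::t2_space \<Rightarrow> 'c::topological_space \<Rightarrow> real"
  assumes cpt: "compact (UNIV :: 'c set)" and F: "continuous_on UNIV (\<lambda>(x, y). F x y)"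
    and M: "prob_space M" "sets M = sets borel"
  shows "continuous_on UNIV (\<lambda>x. \<integral>y. F x y \<partial>M)"
proof -
  interpret prob_space M by fact
  have int: "integrable M (F x)" for x
  proof (rule continuous_integrable[OF cpt _ finite_measure_axioms M(2)])
    show "continuous_on UNIV (F x)"
      using continuous_on_compose2[OF F, of UNIV "\<lambda>y. (x, y)"]
      by (simp add: continuous_on_Pair)
  qed
  have "isCont (\<lambda>x. \<integral>y. F x y \<partial>M) z" for z
    unfolding isCont_def
  proof (rule tendstoI)
    fix e :: real assume "0 < e"
    then have "0 < e / 2"
      by simp
    then obtain A where A: "open A" "z \<in> A" "\<And>x y. x \<in> A \<Longrightarrow> \<bar>F x y - F z y\<bar> \<le> e / 2"
      by (rule uniform_in_compact_parameter[OF cpt F, where z = z]) blast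
    have "dist (\<integral>y. F x y \<partial>M) (\<integral>y. F z y \<partial>M) < e" if "x \<in> A" for x
    proof -
      have "dist (\<integral>y. F x y \<partial>M) (\<integral>y. F z y \<partial>M) = \<bar>\<integral>y. F x y - F z y \<partial>M\<bar>"
        using int by (simp add: dist_real_def)
      also have "\<dots> \<le> (\<integral>y. \<bar>F x y - F z y\<bar> \<partial>M)"
        by (rule integral_abs_bound)
      also have "\<dots> \<le> (\<integral>y. e / 2 \<partial>M)"
        using A(3)[OF that] int by (intro integral_mono) auto
      also have "\<dots> < e"
        using \<open>0 < e\<close> by (simp add: prob_space)
      finally show ?thesis .
    qed
    then show "\<forall>\<^sub>F x in at z. dist (\<integral>y. F x y \<partial>M) (\<integral>y. F z y \<partial>M) < e"
      using A(1,2) by (auto simp: eventually_at_topological)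
  qed
  then show ?thesis
    by (simp add: continuous_on_eq_continuous_at)
qed

text \<open>
  On a nonmetrizable space the product of two Borel sigma-algebras may be strictly smaller than
  the Borel sigma-algebra of the product, but it still makes every continuous real function
  measurable: those continuous functions that are measurable form an algebra that separates points,
  and by the Stone-Weierstrass theorem it is uniformly dense. Only one separating function for each
  pair of points has to be measurable, so the lemma also applies when a factor carries a smaller
  sigma-algebra, such as the one generated by the coordinates of the path.
\<close>

lemma continuous_measurable_pair:
  fixes F :: "'b::t2_space \<times> 'c::t2_space \<Rightarrow> real"
  assumes cpt: "compact (UNIV :: 'b set)" "compact (UNIV :: 'c set)" and F: "continuous_on UNIV F"
    and sepM: "\<And>x y. x \<noteq> y \<Longrightarrow> \<exists>u :: 'b \<Rightarrow> real. continuous_on UNIV u \<and> u \<in> borel_measurable M \<and> u x \<noteq> u y"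
    and sepN: "\<And>x y. x \<noteq> y \<Longrightarrow> \<exists>u :: 'c \<Rightarrow> real. continuous_on UNIV u \<and> u \<in> borel_measurable N \<and> u x \<noteq> u y"
  shows "F \<in> borel_measurable (M \<Otimes>\<^sub>M N)"
proof -
  define R where "R = {f :: 'b \<times> 'c \<Rightarrow> real. continuous_on UNIV f \<and> f \<in> borel_measurable (M \<Otimes>\<^sub>M N)}"
  interpret function_ring_on R "UNIV :: ('b \<times> 'c) set"
  proof
    show "compact (UNIV :: ('b \<times> 'c) set)"
      using compact_Times[OF cpt] by simp
    fix p q :: "'b \<times> 'c" assume "p \<noteq> q"
    then consider "fst p \<noteq> fst q" | "snd p \<noteq> snd q"
      by (auto simp: prod_eq_iff)
    then show "\<exists>f\<in>R. f p \<noteq> f q"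
    proof cases
      case 1
      then obtain u :: "'b \<Rightarrow> real" where u: "continuous_on UNIV u" "u \<in> borel_measurable M" "u (fst p) \<noteq> u (fst q)"
        using sepM by blast
      have "(\<lambda>z. u (fst z)) \<in> R"
        unfolding R_def using u(2) continuous_on_compose2[OF u(1) continuous_on_fst[OF continuous_on_id]]
        by simp
      then show ?thesis
        by (rule rev_bexI) (rule u(3))
    next
      case 2
      then obtain u :: "'c \<Rightarrow> real" where u: "continuous_on UNIV u" "u \<in> borel_measurable N" "u (snd p) \<noteq> u (snd q)"
        using sepN by blast
      have "(\<lambda>z. u (snd z)) \<in> R"
        unfolding R_def using u(2) continuous_on_compose2[OF u(1) continuous_on_snd[OF continuous_on_id]]
        by simp
      then show ?thesis
        by (rule rev_bexI) (rule u(3))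
    qed
  qed (auto simp: R_def intro!: continuous_intros)
  obtain g where g: "g \<in> UNIV \<rightarrow> R" "uniform_limit UNIV g F sequentially"
    using Stone_Weierstrass[OF F] by auto
  show ?thesis
  proof (rule borel_measurable_LIMSEQ_metric)
    show "g i \<in> borel_measurable (M \<Otimes>\<^sub>M N)" for i
      using g(1) by (auto simp: R_def)
    show "(\<lambda>i. g i x) \<longlonglongrightarrow> F x" for x
      using tendsto_uniform_limitI[OF g(2)] by simp
  qed
qed

lemma Fubini_continuous:
  fixes F :: "'b::t2_space \<Rightarrow> 'c::t2_space \<Rightarrow> real"
  assumes cpt: "compact (UNIV :: 'b set)" "compact (UNIV :: 'c set)"
    and F: "continuous_on UNIV (\<lambda>(x, y). F x y)"
    and M: "prob_space M" "sets M = sets borel" and N: "prob_space N" "sets N = sets borel"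
  shows "(\<integral>x. (\<integral>y. F x y \<partial>N) \<partial>M) = (\<integral>y. (\<integral>x. F x y \<partial>M) \<partial>N)"
proof -
  interpret M: prob_space M by fact
  interpret N: prob_space N by fact
  interpret pair_prob_space M N ..
  have sep: "\<exists>u :: 'd \<Rightarrow> real. continuous_on UNIV u \<and> u \<in> borel_measurable L \<and> u x \<noteq> u y"
    if c: "compact (UNIV :: 'd set)" "sets L = sets borel" "x \<noteq> y" for x y :: "'d::t2_space" and L
  proof -
    obtain u :: "'d \<Rightarrow> real" where u: "continuous_on UNIV u" "u x \<noteq> u y"
      using separate_points[OF c(1,3)] .
    with borel_measurable_continuous_onI[OF u(1)] c(2) show ?thesis
      by (intro exI[of _ u]) (simp cong: measurable_cong_sets)
  qed
  have "(\<lambda>(x, y). F x y) \<in> borel_measurable (M \<Otimes>\<^sub>M N)"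
    by (rule continuous_measurable_pair[OF cpt F sep[OF cpt(1) M(2)] sep[OF cpt(2) N(2)]])
  moreover have "bounded (range (\<lambda>(x, y). F x y))"
    using compact_Times[OF cpt] F
    by (intro compact_imp_bounded compact_continuous_image) auto
  then obtain B where "\<And>p. norm (case p of (x, y) \<Rightarrow> F x y) \<le> B"
    by (auto simp: bounded_iff)
  ultimately have "integrable (M \<Otimes>\<^sub>M N) (\<lambda>(x, y). F x y)"
    by (intro P.integrable_const_bound[where B = B]) auto
  then show ?thesis
    by (rule Fubini_integral[symmetric])
qed

section \<open>Regular probability measures\<close>

lemma regular_probD:
  assumes "regular_prob M"
  shows "prob_space M" "sets M = sets borel" "space M = UNIV"
  using assms sets_eq_imp_space_eq[of M borel] by (auto simp: regular_prob_def)

lemma regular_prob_approx: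
  assumes "regular_prob M" "A \<in> sets borel" "0 < e"
  obtains K where "K \<subseteq> A" "compact K" "measure M A < measure M K + e"
proof -
  interpret prob_space M
    using regular_probD[OF assms(1)] by simp
  have "(\<exists>K. K \<subseteq> A \<and> compact K \<and> measure M A < measure M K + e)"
  proof (rule ccontr)
    assume "\<not> ?thesis"
    then have le: "measure M K \<le> measure M A - e" if "K \<subseteq> A" "compact K" for K
      using that by force
    have "emeasure M A = (SUP K\<in>{K. K \<subseteq> A \<and> compact K}. emeasure M K)"
      using assms by (simp add: regular_prob_def)
    also have "\<dots> \<le> ennreal (measure M A - e)"
      using le by (intro SUP_least) (auto simp: emeasure_eq_measure intro!: ennreal_leI)
    finally have "measure M A \<le> measure M A - e"
      using le[of "{}"] by (simp add: emeasure_eq_measure ennreal_le_iff)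
    with assms(3) show False by simp
  qed
  with that show thesis by blast
qed

lemma regular_probI:
  fixes M :: "'b::t2_space measure"
  assumes "prob_space M" "sets M = sets borel"
    and approx: "\<And>A e. A \<in> sets borel \<Longrightarrow> 0 < e \<Longrightarrow> \<exists>K\<subseteq>A. compact K \<and> measure M A < measure M K + e"
  shows "regular_prob M"
  unfolding regular_prob_def
proof (intro conjI ballI assms antisym)
  interpret prob_space M by fact
  fix A :: "'b set" assume A: "A \<in> sets borel"
  show "(SUP K\<in>{K. K \<subseteq> A \<and> compact K}. emeasure M K) \<le> emeasure M A"
    using A assms(2) by (intro SUP_least emeasure_mono) auto
  show "emeasure M A \<le> (SUP K\<in>{K. K \<subseteq> A \<and> compact K}. emeasure M K)" (is "_ \<le> ?S")
  proof (rule ennreal_le_epsilon)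
    fix e :: real assume "0 < e"
    then obtain K where K: "K \<subseteq> A" "compact K" "measure M A < measure M K + e"
      using approx[OF A] by blast
    have "emeasure M A \<le> emeasure M K + ennreal e"
      using K \<open>0 < e\<close> by (simp add: emeasure_eq_measure flip: ennreal_plus)
    also have "emeasure M K \<le> ?S"
      using K by (intro SUP_upper) auto
    finally show "emeasure M A \<le> ?S + ennreal e"
      by (simp add: add_right_mono)
  qed
qed

text \<open>
  Inner regularity of \<open>N\<close> on the complement of \<open>K\<close> gives a compact set \<open>C\<close> that misses \<open>K\<close> and
  carries almost all of \<open>N\<close> outside \<open>K\<close>; a Urysohn function between \<open>C\<close> and \<open>K\<close> then compares
  the two measures.
\<close>

lemma regular_prob_le_on_compact:
  fixes M N :: "'b::t2_space measure"
  assumes cpt: "compact (UNIV :: 'b set)" and M: "regular_prob M" and N: "regular_prob N"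
    and eq: "\<And>f :: 'b \<Rightarrow> real. continuous_on UNIV f \<Longrightarrow> (\<integral>x. f x \<partial>M) = (\<integral>x. f x \<partial>N)"
    and "compact K"
  shows "measure M K \<le> measure N K"
proof (rule field_le_epsilon)
  interpret M: prob_space M using regular_probD[OF M] by simp
  interpret N: prob_space N using regular_probD[OF N] by simp
  note [simp] = regular_probD[OF M] regular_probD[OF N]
  have [simp]: "closed K" by (rule compact_imp_closed) fact
  fix e :: real assume "0 < e"
  then obtain C where C: "C \<subseteq> - K" "compact C" "measure N (- K) < measure N C + e"
    using regular_prob_approx[OF N, of "- K" e] by auto
  have [simp]: "closed C" by (rule compact_imp_closed) fact
  obtain f :: "'b \<Rightarrow> real" where f: "continuous_on UNIV f" "range f \<subseteq> {0..1}"
    "\<And>x. x \<in> C \<Longrightarrow> f x = 0" "\<And>x. x \<in> K \<Longrightarrow> f x = 1"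
    using Urysohn_compact[OF cpt, of C K] C by auto
  have f01: "0 \<le> f x" "f x \<le> 1" for x
    using f(2) by (auto simp: image_subset_iff)
  have "measure M K = (\<integral>x. indicator K x \<partial>M)"
    by simp
  also have "\<dots> \<le> (\<integral>x. f x \<partial>M)"
    using f01 by (intro integral_mono[OF integrable_real_indicator continuous_integrable[OF cpt f(1)]])
      (auto simp: indicator_def f(4) M.finite_measure_axioms M.emeasure_eq_measure)
  also have "\<dots> = (\<integral>x. f x \<partial>N)"
    by (rule eq) fact
  also have "\<dots> \<le> (\<integral>x. indicator (- C) x \<partial>N)"
    using f01 by (intro integral_mono[OF continuous_integrable[OF cpt f(1)] integrable_real_indicator])
      (auto simp: indicator_def f(3) N.finite_measure_axioms N.emeasure_eq_measure)
  also have "\<dots> = 1 - measure N C"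
    using N.prob_compl[of C] by (simp add: Compl_eq_Diff_UNIV)
  also have "\<dots> \<le> measure N K + e"
    using C(3) N.prob_compl[of K] by (simp add: Compl_eq_Diff_UNIV)
  finally show "measure M K \<le> measure N K + e" .
qed

lemma regular_prob_eqI:
  fixes M N :: "'b::t2_space measure"
  assumes cpt: "compact (UNIV :: 'b set)" and M: "regular_prob M" and N: "regular_prob N"
    and eq: "\<And>f :: 'b \<Rightarrow> real. continuous_on UNIV f \<Longrightarrow> (\<integral>x. f x \<partial>M) = (\<integral>x. f x \<partial>N)"
  shows "M = N"
proof (rule measure_eqI)
  interpret M: prob_space M using regular_probD[OF M] by simp
  interpret N: prob_space N using regular_probD[OF N] by simp
  show "sets M = sets N"
    using regular_probD[OF M] regular_probD[OF N] by simp
  fix A assume "A \<in> sets M"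
  then have A: "A \<in> sets borel"
    using regular_probD[OF M] by simp
  have "emeasure M K = emeasure N K" if "compact K" for K
    using regular_prob_le_on_compact[OF cpt M N eq that]
      regular_prob_le_on_compact[OF cpt N M eq[symmetric] that]
    by (simp add: M.emeasure_eq_measure N.emeasure_eq_measure)
  then show "emeasure M A = emeasure N A"
    using M N A by (simp add: regular_prob_def)
qed

lemma regular_prob_distr:
  fixes f :: "'b::t2_space \<Rightarrow> 'c::t2_space"
  assumes M: "regular_prob M" and f: "continuous_on UNIV f"
  shows "regular_prob (distr M borel f)"
proof (rule regular_probI)
  interpret M: prob_space M using regular_probD[OF M] by simp
  note [simp] = regular_probD[OF M]
  have meas [measurable]: "f \<in> measurable M borel"
    using borel_measurable_continuous_onI[OF f] by (simp cong: measurable_cong_sets)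
  show "prob_space (distr M borel f)"
    by (rule M.prob_space_distr) simp
  show "\<exists>K\<subseteq>A. compact K \<and> measure (distr M borel f) A < measure (distr M borel f) K + e"
    if "A \<in> sets borel" "0 < e" for A e
  proof -
    have "f -` A \<in> sets borel"
      using measurable_sets[OF meas that(1)] by simp
    then obtain K where K: "K \<subseteq> f -` A" "compact K" "measure M (f -` A) < measure M K + e"
      using regular_prob_approx[OF M _ \<open>0 < e\<close>] by blast
    have cK: "compact (f ` K)"
      using K f by (meson compact_continuous_image continuous_on_subset subset_UNIV)
    have [measurable]: "f ` K \<in> sets borel"
      using compact_imp_closed[OF cK] by simp
    have "measure M K \<le> measure M (f -` f ` K)"
      using measurable_sets[OF meas, of "f ` K"] by (intro M.finite_measure_mono) auto
    then have "measure (distr M borel f) A < measure (distr M borel f) (f ` K) + e"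
      using K that by (simp add: measure_distr)
    then show ?thesis
      using K cK by (intro exI[of _ "f ` K"]) auto
  qed
qed simp

text \<open>
  A compact set that nearly exhausts \<open>A\<close> for \<open>M\<close> also nearly exhausts it for \<open>N\<close>, because the
  difference is dominated. This makes limits of densities regular without any compactness of the
  space of measures.
\<close>

lemma regular_prob_dominated:
  fixes M N :: "'b::t2_space measure"
  assumes M: "regular_prob M" and N: "prob_space N" "sets N = sets borel"
    and le: "\<And>A. A \<in> sets borel \<Longrightarrow> measure N A \<le> C * measure M A"
  shows "regular_prob N"
proof (rule regular_probI[OF N])
  interpret M: prob_space M using regular_probD[OF M] by simp
  interpret N: prob_space N by fact
  note [simp] = regular_probD[OF M]
  have [simp]: "space N = UNIV"
    using sets_eq_imp_space_eq[OF N(2)] by simp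
  have "0 < C"
  proof -
    have "1 \<le> C"
      using le[of UNIV] N.prob_space M.prob_space by simp
    then show ?thesis by simp
  qed
  fix A :: "'b set" and e :: real
  assume A: "A \<in> sets borel" and "0 < e"
  then obtain K where K: "K \<subseteq> A" "compact K" "measure M A < measure M K + e / C"
    using regular_prob_approx[OF M A, of "e / C"] \<open>0 < C\<close> by auto
  have [simp]: "K \<in> sets borel"
    using compact_imp_closed[OF K(2)] by simp
  have "measure N A - measure N K = measure N (A - K)"
    using K A N by (subst N.finite_measure_Diff) auto
  also have "\<dots> \<le> C * measure M (A - K)"
    using A by (intro le) auto
  also have "\<dots> = C * (measure M A - measure M K)"
    using K A by (subst M.finite_measure_Diff) auto
  also have "\<dots> < C * (e / C)"
    using K \<open>0 < C\<close> by (intro mult_strict_left_mono) auto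
  finally show "\<exists>K\<subseteq>A. compact K \<and> measure N A < measure N K + e"
    using K \<open>0 < C\<close> by (intro exI[of _ K]) auto
qed

section \<open>Past, noise and solutions\<close>

lemma past_subset_borel: "past n \<subseteq> sets (borel :: (nat \<Rightarrow> 'a::topological_space) measure)"
proof -
  have "(\<lambda>x. x m) -` A \<in> sets borel" if "A \<in> sets borel" for m and A :: "'a set"
    using measurable_sets[OF borel_measurable_continuous_onI[OF continuous_on_product_coordinates] that]
    by simp
  then have "{(\<lambda>x. x m) -` A | m A. n \<le> m \<and> A \<in> sets borel} \<subseteq> sets (borel :: (nat \<Rightarrow> 'a) measure)"
    by auto
  then show ?thesis
    unfolding past_def using sets.sigma_sets_subset[of _ "borel :: (nat \<Rightarrow> 'a) measure"] by simp
qed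

lemma past_antimono: "m \<le> n \<Longrightarrow> past n \<subseteq> past m"
  unfolding past_def by (rule sigma_sets_mono') force

lemma sets_past: "sets (sigma UNIV (past n)) = past n"
  unfolding past_def by (simp add: sigma_sets_sigma_sets_eq)

lemma measurable_pastI:
  assumes "f \<in> measurable (sigma UNIV (past n)) N" "m \<le> n"
  shows "f \<in> measurable (sigma UNIV (past m)) N"
proof (rule measurable_mono[THEN subsetD, OF order_refl refl _ _ assms(1)])
  show "sets (sigma UNIV (past n)) \<subseteq> sets (sigma UNIV (past m))"
    unfolding sets_past by (rule past_antimono) fact
qed simp

lemma measurable_past_imp_borel:
  assumes "f \<in> measurable (sigma UNIV (past n)) N" "sets P = sets borel"
  shows "f \<in> measurable P N"
proof (rule measurable_mono[THEN subsetD, OF order_refl refl _ _ assms(1)])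
  show "sets (sigma UNIV (past n)) \<subseteq> sets P"
    unfolding sets_past assms(2) by (rule past_subset_borel)
  show "space (sigma UNIV (past n)) = space P"
    using sets_eq_imp_space_eq[OF assms(2)] by simp
qed

lemma measurable_past_coordinate:
  assumes "n \<le> m"
  shows "(\<lambda>x. x m :: 'a::topological_space) \<in> measurable (sigma UNIV (past n)) borel"
proof (rule measurableI)
  fix A :: "'a set" assume "A \<in> sets borel"
  then have "(\<lambda>x. x m) -` A \<in> past n"
    unfolding past_def using assms by (intro sigma_sets.Basic) blast
  then show "(\<lambda>x. x m) -` A \<inter> space (sigma UNIV (past n)) \<in> sets (sigma UNIV (past n))"
    by (simp add: sets_past)
qed simp

lemma continuous_on_noise:
  "continuous_on UNIV (noise n :: (nat \<Rightarrow> 'a::topological_group_add) \<Rightarrow> 'a)"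
  unfolding noise_def[abs_def] by (intro continuous_intros continuous_on_product_coordinates)

lemma noise_measurable:
  "sets P = sets borel \<Longrightarrow>
    (noise n :: (nat \<Rightarrow> 'a::topological_group_add) \<Rightarrow> 'a) \<in> measurable P borel"
  using borel_measurable_continuous_onI[OF continuous_on_noise] by (simp cong: measurable_cong_sets)

text \<open>
  Independence and the law of the noise in a single product formula, which passes to
  setwise limits of measures and to translates.
\<close>

lemma solutions_iff:
  fixes \<mu> :: "nat \<Rightarrow> 'a::topological_group_add measure"
  assumes \<mu>: "\<And>n. prob_space (\<mu> n)" "\<And>n. sets (\<mu> n) = sets borel"
  shows "P \<in> solutions \<mu> \<longleftrightarrow> regular_prob P \<and>
    (\<forall>n. \<forall>B\<in>sets borel. \<forall>C\<in>past (Suc n).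
      measure P (noise n -` B \<inter> C) = measure (\<mu> n) B * measure P C)"
proof (cases "regular_prob P")
  case True
  interpret prob_space P using regular_probD[OF True] by simp
  note [simp] = regular_probD[OF True]
  have [simp]: "UNIV \<in> past m" for m :: nat
    unfolding past_def by (rule sigma_sets_top)
  have noise: "measure (distr P borel (noise n)) B = measure P (noise n -` B)"
    if "B \<in> sets borel" for n and B :: "'a set"
    using that by (simp add: measure_distr noise_measurable)
  have ev: "noise n -` B \<in> sets borel" if "B \<in> sets borel" for n and B :: "'a set"
    using measurable_sets[OF noise_measurable[of P n] that] by simp
  have "(indep_set {noise n -` A | A. A \<in> sets borel} (past (Suc n)) \<and>
      distr P borel (noise n) = \<mu> n) \<longleftrightarrow>
    (\<forall>B\<in>sets borel. \<forall>C\<in>past (Suc n).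
      measure P (noise n -` B \<inter> C) = measure (\<mu> n) B * measure P C)" (is "?L \<longleftrightarrow> ?R") for n
  proof
    assume L: ?L
    show ?R
    proof (intro ballI)
      fix B :: "'a set" and C :: "(nat \<Rightarrow> 'a) set"
      assume "B \<in> sets borel" "C \<in> past (Suc n)"
      with L have "measure P (noise n -` B \<inter> C) = measure P (noise n -` B) * measure P C"
        by (intro indep_setD[of _ "past (Suc n)"]) auto
      then show "measure P (noise n -` B \<inter> C) = measure (\<mu> n) B * measure P C"
        using L noise[OF \<open>B \<in> sets borel\<close>, of n] by simp
    qed
  next
    assume R: ?R
    have B: "measure P (noise n -` B) = measure (\<mu> n) B" if "B \<in> sets borel" for B
      using R[rule_format, OF that, of UNIV] prob_space by simp
    have "indep_set {noise n -` A | A. A \<in> sets borel} (past (Suc n))"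
      unfolding indep_sets2_eq using R B ev past_subset_borel[of "Suc n"] by auto
    moreover have "distr P borel (noise n) = \<mu> n"
    proof (rule measure_eqI)
      interpret N: prob_space "\<mu> n" by (rule \<mu>)
      interpret D: prob_space "distr P borel (noise n)"
        by (rule prob_space_distr) (simp add: noise_measurable)
      fix A assume "A \<in> sets (distr P borel (noise n))"
      then show "emeasure (distr P borel (noise n)) A = emeasure (\<mu> n) A"
        using noise[of A n] B[of A] by (simp add: N.emeasure_eq_measure D.emeasure_eq_measure)
    qed (simp add: \<mu>)
    ultimately show ?L ..
  qed
  then show ?thesis
    unfolding solutions_def using True by simp
qed (simp add: solutions_def)

lemma solutionsD:
  assumes "P \<in> solutions \<mu>"
  shows "regular_prob P" "distr P borel (noise n) = \<mu> n"
  using assms by (auto simp: solutions_def)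

text \<open>
  The pair law lives on a product sigma-algebra with one factor for the past and one for
  the noise, so that Fubini's theorem applies to it.
\<close>

lemma solution_joint_law:
  fixes \<mu> :: "nat \<Rightarrow> 'a::topological_group_add measure"
  assumes P: "P \<in> solutions \<mu>" and Y: "Y \<in> measurable (sigma UNIV (past (Suc n))) N"
  shows "distr P N Y \<Otimes>\<^sub>M \<mu> n = distr P (N \<Otimes>\<^sub>M borel) (\<lambda>x. (Y x, noise n x))"
proof -
  note reg = solutionsD(1)[OF P] and law = solutionsD(2)[OF P, of n]
  note [simp] = regular_probD[OF reg]
  interpret prob_space P by simp
  have [measurable]: "Y \<in> measurable P N"
    using measurable_past_imp_borel[OF Y] by simp
  have [measurable]: "noise n \<in> measurable P borel"
    by (rule noise_measurable) simp
  interpret T: prob_space "distr P N Y"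
    by (rule prob_space_distr) simp
  interpret M: prob_space "\<mu> n"
    using prob_space_distr[of "noise n" borel] law by simp
  have sets_\<mu>: "sets (\<mu> n) = sets borel"
    using law by (metis sets_distr)
  show ?thesis
  proof (rule pair_measure_eqI)
    fix A B assume "A \<in> sets (distr P N Y)" "B \<in> sets (\<mu> n)"
    then have A: "A \<in> sets N" and B: "B \<in> sets borel"
      by (simp_all add: sets_\<mu>)
    have "Y -` A \<in> past (Suc n)"
      using measurable_sets[OF Y A] by (simp add: sets_past)
    then have "measure P (noise n -` B \<inter> Y -` A) = measure P (noise n -` B) * measure P (Y -` A)"
      using P B by (intro indep_setD[of _ "past (Suc n)"]) (auto simp: solutions_def)
    moreover have "measure P (noise n -` B) = measure (\<mu> n) B"
      using B by (simp add: law[symmetric] measure_distr)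
    moreover have "(\<lambda>x. (Y x, noise n x)) -` (A \<times> B) = noise n -` B \<inter> Y -` A"
      by auto
    ultimately show "emeasure (distr P N Y) A * emeasure (\<mu> n) B =
        emeasure (distr P (N \<Otimes>\<^sub>M borel) (\<lambda>x. (Y x, noise n x))) (A \<times> B)"
      using A B by (simp add: emeasure_distr emeasure_eq_measure M.emeasure_eq_measure
          mult.commute flip: ennreal_mult)
  qed (auto intro!: T.sigma_finite_measure_axioms M.sigma_finite_measure_axioms
      simp: sets_\<mu> cong: sets_pair_measure_cong)
qed

lemma solution_integral_noise:
  fixes \<mu> :: "nat \<Rightarrow> 'a::topological_group_add measure" and F :: "'b \<times> 'a \<Rightarrow> real"
  assumes P: "P \<in> solutions \<mu>" and Y: "Y \<in> measurable (sigma UNIV (past (Suc n))) N"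
    and F [measurable]: "F \<in> borel_measurable (N \<Otimes>\<^sub>M borel)"
    and int: "integrable P (\<lambda>x. F (Y x, noise n x))"
  shows "(\<integral>x. F (Y x, noise n x) \<partial>P) = (\<integral>x. (\<integral>s. F (Y x, s) \<partial>\<mu> n) \<partial>P)"
proof -
  note reg = solutionsD(1)[OF P] and law = solutionsD(2)[OF P, of n]
  note joint = solution_joint_law[OF P Y]
  note [simp] = regular_probD[OF reg]
  interpret prob_space P by simp
  have YP [measurable]: "Y \<in> measurable P N"
    using measurable_past_imp_borel[OF Y] by simp
  have [measurable]: "noise n \<in> measurable P borel"
    by (rule noise_measurable) simp
  interpret T: prob_space "distr P N Y"
    by (rule prob_space_distr) simp
  interpret M: prob_space "\<mu> n"
    using prob_space_distr[of "noise n" borel] law by simp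
  interpret pair_prob_space "distr P N Y" "\<mu> n" ..
  have sets_\<mu>: "sets (\<mu> n) = sets borel"
    using law by (metis sets_distr)
  have "(\<integral>x. F (Y x, noise n x) \<partial>P) =
      (\<integral>p. F p \<partial>distr P (N \<Otimes>\<^sub>M borel) (\<lambda>x. (Y x, noise n x)))"
    by (rule integral_distr[symmetric]) simp_all
  also have "\<dots> = (\<integral>y. (\<integral>s. F (y, s) \<partial>\<mu> n) \<partial>distr P N Y)"
  proof -
    have "integrable (distr P N Y \<Otimes>\<^sub>M \<mu> n) F"
      unfolding joint using int by (subst integrable_distr_eq) simp_all
    then show ?thesis
      unfolding joint[symmetric] by (rule integral_fst'[symmetric])
  qed
  also have "\<dots> = (\<integral>x. (\<integral>s. F (Y x, s) \<partial>\<mu> n) \<partial>P)"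
  proof (rule integral_distr[OF YP])
    show "(\<lambda>y. \<integral>s. F (y, s) \<partial>\<mu> n) \<in> borel_measurable N"
      using M.borel_measurable_lebesgue_integral[of "\<lambda>y s. F (y, s)" N] F
      by (simp cong: measurable_cong_sets sets_pair_measure_cong add: sets_\<mu>)
  qed
  finally show ?thesis .
qed

section \<open>The action of the group by translations\<close>

lemma continuous_on_translation:
  "continuous_on UNIV (\<lambda>(g, x :: nat \<Rightarrow> 'a::topological_group_add) n. g + x n)"
proof (rule continuous_on_coordinatewise_then_product)
  fix n
  have "continuous_on UNIV (\<lambda>p :: 'a \<times> (nat \<Rightarrow> 'a). snd p n)"
    by (rule continuous_on_compose2[OF continuous_on_product_coordinates continuous_on_snd[OF continuous_on_id]]) simp
  then show "continuous_on UNIV (\<lambda>p. (case p of (g, x :: nat \<Rightarrow> 'a) \<Rightarrow> \<lambda>n. g + x n) n)"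
    unfolding case_prod_beta' by (intro continuous_intros)
qed

lemma continuous_on_translate_path:
  "continuous_on UNIV (\<lambda>(x :: nat \<Rightarrow> 'a::topological_group_add) n. g + x n)"
  using continuous_on_compose2[OF continuous_on_translation, of UNIV "\<lambda>x. (g, x)"]
  by (simp add: continuous_on_Pair)

lemma translate_path_measurable:
  "sets P = sets borel \<Longrightarrow>
    (\<lambda>(x :: nat \<Rightarrow> 'a::topological_group_add) n. g + x n) \<in> measurable P borel"
  using borel_measurable_continuous_onI[OF continuous_on_translate_path]
  by (simp cong: measurable_cong_sets)

lemma sets_translate [simp]: "sets (translate g P) = sets borel"
  by (simp add: translate_def)

lemma regular_prob_translate:
  fixes P :: "(nat \<Rightarrow> 'a::{topological_group_add, t2_space}) measure"
  shows "regular_prob P \<Longrightarrow> regular_prob (translate g P)"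
  unfolding translate_def by (rule regular_prob_distr[OF _ continuous_on_translate_path])

lemma integral_translate:
  fixes f :: "(nat \<Rightarrow> 'a::topological_group_add) \<Rightarrow> real"
  assumes "continuous_on UNIV f" "sets P = sets borel"
  shows "(\<integral>x. f x \<partial>translate g P) = (\<integral>x. f (\<lambda>n. g + x n) \<partial>P)"
  unfolding translate_def
  by (rule integral_distr[OF translate_path_measurable borel_measurable_continuous_onI])
    (use assms in auto)

lemma measure_translate:
  fixes P :: "(nat \<Rightarrow> 'a::topological_group_add) measure"
  assumes "sets P = sets borel" "A \<in> sets borel"
  shows "measure (translate g P) A = measure P ((\<lambda>x n. g + x n) -` A)"
  unfolding translate_def using assms sets_eq_imp_space_eq[OF assms(1)]
  by (simp add: measure_distr translate_path_measurable)

lemma translate_translate: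
  fixes P :: "(nat \<Rightarrow> 'a::topological_group_add) measure"
  assumes "sets P = sets borel"
  shows "translate g (translate h P) = translate (g + h) P"
  unfolding translate_def
  by (subst distr_distr) (auto simp: translate_path_measurable assms o_def add.assoc)

lemma translate_0:
  fixes P :: "(nat \<Rightarrow> 'a::topological_group_add) measure"
  assumes "sets P = sets borel"
  shows "translate 0 P = P"
  unfolding translate_def by (simp add: distr_id2 assms)

lemma translate_eq_iff:
  fixes P Q :: "(nat \<Rightarrow> 'a::topological_group_add) measure"
  assumes "sets P = sets borel" "sets Q = sets borel"
  shows "translate g P = Q \<longleftrightarrow> P = translate (- g) Q"
  using assms by (auto simp: translate_translate translate_0)

lemma past_vimage_translate:
  fixes C :: "(nat \<Rightarrow> 'a::topological_group_add) set"
  assumes "C \<in> past n"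
  shows "(\<lambda>x n. g + x n) -` C \<in> past n"
proof -
  have "(\<lambda>x n. g + x n) \<in> measurable (sigma UNIV (past n)) (sigma UNIV (past n))"
  proof (rule measurable_sigma_sets[where A = "{(\<lambda>x :: nat \<Rightarrow> 'a. x m) -` A | m A. n \<le> m \<and> A \<in> sets borel}"])
    fix D assume "D \<in> {(\<lambda>x :: nat \<Rightarrow> 'a. x m) -` A | m A. n \<le> m \<and> A \<in> sets borel}"
    then obtain m A where D: "D = (\<lambda>x. x m) -` A" "n \<le> m" "A \<in> sets borel"
      by blast
    have "(+) g -` A \<in> sets borel"
      using measurable_sets[OF borel_measurable_continuous_onI[of "(+) g"] D(3)]
      by (simp add: continuous_intros)
    then have "(\<lambda>x. x m) -` ((+) g -` A) \<in> past n"
      unfolding past_def using D(2) by (intro sigma_sets.Basic) blast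
    then show "(\<lambda>x n. g + x n) -` D \<inter> space (sigma UNIV (past n)) \<in> sets (sigma UNIV (past n))"
      by (simp add: sets_past D(1) vimage_def)
  qed (auto simp: past_def sigma_sets_sigma_sets_eq)
  from measurable_sets[OF this, of C] assms show ?thesis
    by (simp add: sets_past)
qed

lemma noise_translate: "noise n (\<lambda>m. g + x m) = noise n x"
  by (simp only: noise_def minus_add add.assoc minus_add_cancel)

text \<open>
  A left translation cancels in \<open>\<eta>\<^bsub>k-1\<^esub>\<^sup>-\<^sup>1 \<cdot> \<eta>\<^sub>k\<close> and maps the past to itself.
\<close>

lemma translate_solutions:
  fixes \<mu> :: "nat \<Rightarrow> 'a::{topological_group_add, t2_space} measure"
  assumes \<mu>: "\<And>n. prob_space (\<mu> n)" "\<And>n. sets (\<mu> n) = sets borel"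
    and P: "P \<in> solutions \<mu>"
  shows "translate g P \<in> solutions \<mu>"
  unfolding solutions_iff[OF \<mu>]
proof (intro conjI allI ballI)
  note reg = solutionsD(1)[OF P]
  note setsP = regular_probD(2)[OF reg]
  show "regular_prob (translate g P)"
    by (rule regular_prob_translate) fact
  fix n and B :: "'a set" and C :: "(nat \<Rightarrow> 'a) set"
  assume B: "B \<in> sets borel" and C: "C \<in> past (Suc n)"
  let ?T = "\<lambda>x n. g + x n :: 'a"
  have Cb: "C \<in> sets borel"
    using C past_subset_borel by blast
  moreover have "noise n -` B \<in> sets borel"
    using measurable_sets[OF noise_measurable[of borel n] B] by simp
  moreover have "?T -` (noise n -` B \<inter> C) = noise n -` B \<inter> ?T -` C"
    by (auto simp: noise_translate)
  ultimately show "measure (translate g P) (noise n -` B \<inter> C) =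
      measure (\<mu> n) B * measure (translate g P) C"
    using P B past_vimage_translate[OF C, of g]
    by (simp add: measure_translate[OF setsP] sets.Int solutions_iff[OF \<mu>])
qed

text \<open>
  Translating a convex decomposition of \<open>translate g P\<close> back by \<open>- g\<close> decomposes \<open>P\<close>.
\<close>

lemma translate_extremal:
  fixes \<mu> :: "nat \<Rightarrow> 'a::{topological_group_add, t2_space} measure"
  assumes \<mu>: "\<And>n. prob_space (\<mu> n)" "\<And>n. sets (\<mu> n) = sets borel"
    and P: "P \<in> extremal_solutions \<mu>"
  shows "translate g P \<in> extremal_solutions \<mu>"
proof -
  have sol: "P \<in> solutions \<mu>"
    using P by (simp add: extremal_solutions_def)
  have setsP: "sets Q = sets borel" if "Q \<in> solutions \<mu>" for Q
    using regular_probD(2)[OF solutionsD(1)[OF that]] .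
  have False if Q: "Q \<in> solutions \<mu>" and R: "R \<in> solutions \<mu>" and "Q \<noteq> R" and t: "0 < t" "t < 1"
    and dec: "\<forall>A\<in>sets borel. measure (translate g P) A = (1 - t) * measure Q A + t * measure R A"
    for Q R and t :: real
  proof -
    have "translate (- g) Q \<noteq> translate (- g) R"
      using \<open>Q \<noteq> R\<close> setsP[OF Q] setsP[OF R]
      by (simp add: translate_eq_iff translate_translate translate_0)
    moreover have "measure P A = (1 - t) * measure (translate (- g) Q) A + t * measure (translate (- g) R) A"
      if A: "A \<in> sets borel" for A
    proof -
      let ?B = "(\<lambda>x n. - g + x n) -` A"
      have B: "?B \<in> sets borel"
        using measurable_sets[OF translate_path_measurable[of borel "- g"] A] by simp
      have "(\<lambda>x n. g + x n) -` ?B = A"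
        by (auto simp: add.assoc[symmetric])
      then have "measure P A = measure (translate g P) ?B"
        using measure_translate[OF setsP[OF sol] B, of g] by simp
      with dec B A show ?thesis
        by (simp add: measure_translate setsP[OF Q] setsP[OF R])
    qed
    ultimately show False
      using P t translate_solutions[OF \<mu> Q, of "- g"] translate_solutions[OF \<mu> R, of "- g"]
      unfolding extremal_solutions_def by blast
  qed
  then show ?thesis
    using translate_solutions[OF \<mu> sol] unfolding extremal_solutions_def by blast
qed

section \<open>Resampling the noise after a given time\<close>

text \<open>
  Under a solution, this is the conditional expectation of \<open>f\<close> given the coordinates from \<open>k\<close> on, that is, given the past up
  to time \<open>-k\<close>: the coordinates below \<open>k\<close> are rebuilt, starting from \<open>x k\<close>, with
  independent noise. It is an iterated integral and so a function defined at every path, not only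
  almost everywhere.
\<close>

primrec resample ::
    "(nat \<Rightarrow> 'a::group_add measure) \<Rightarrow> nat \<Rightarrow> ((nat \<Rightarrow> 'a) \<Rightarrow> real) \<Rightarrow> (nat \<Rightarrow> 'a) \<Rightarrow> real" where
  "resample \<mu> 0 f = f"
| "resample \<mu> (Suc k) f = (\<lambda>x. \<integral>s. resample \<mu> k f (x(k := x (Suc k) + s)) \<partial>\<mu> k)"

text \<open>
  The coordinates below \<open>k\<close> have been integrated out.
\<close>

lemma resample_cong:
  "(\<And>j. k \<le> j \<Longrightarrow> x j = y j) \<Longrightarrow> resample \<mu> k f x = resample \<mu> k f y"
proof (induction k arbitrary: x y)
  case 0
  then have "x = y" by auto
  then show ?case by simp
next
  case (Suc k)
  have "resample \<mu> k f (x(k := x (Suc k) + s)) = resample \<mu> k f (y(k := y (Suc k) + s))" for s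
    using Suc.prems by (intro Suc.IH) (auto simp: le_Suc_eq)
  then show ?case by simp
qed

lemma continuous_on_extend:
  "continuous_on UNIV (\<lambda>p :: (nat \<Rightarrow> 'a::topological_group_add) \<times> 'a. (fst p)(k := fst p (Suc k) + snd p))"
proof (rule continuous_on_coordinatewise_then_product)
  have c: "continuous_on UNIV (\<lambda>p :: (nat \<Rightarrow> 'a) \<times> 'a. fst p j)" for j
    by (rule continuous_on_compose2[OF continuous_on_product_coordinates continuous_on_fst[OF continuous_on_id]]) simp
  show "continuous_on UNIV (\<lambda>p :: (nat \<Rightarrow> 'a) \<times> 'a. ((fst p)(k := fst p (Suc k) + snd p)) j)" for j
    by (cases "j = k") (auto intro!: continuous_intros c)
qed

lemma continuous_on_resample:
  fixes \<mu> :: "nat \<Rightarrow> 'a::{topological_group_add, t2_space} measure"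
  assumes cpt: "compact (UNIV :: 'a set)"
    and \<mu>: "\<And>n. prob_space (\<mu> n)" "\<And>n. sets (\<mu> n) = sets borel"
    and "continuous_on UNIV f"
  shows "continuous_on UNIV (resample \<mu> k f)"
proof (induction k)
  case (Suc k)
  have "continuous_on UNIV (\<lambda>(x, s). resample \<mu> k f (x(k := x (Suc k) + s)))"
    unfolding case_prod_beta' by (rule continuous_on_compose2[OF Suc.IH continuous_on_extend]) simp
  then show ?case
    unfolding resample.simps by (rule continuous_on_integral_parameter[OF cpt]) (rule \<mu>)+
qed (simp add: assms)

text \<open>
  The coordinate \<open>x k\<close> is \<open>x (Suc k)\<close> times the noise, and the noise is independent of the
  coordinates from \<open>Suc k\<close> on; so it can be integrated out first. Measurability of \<open>g\<close> on the
  product of the sigma-algebra generated by the coordinates with the Borel sets of the group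
  comes from continuity, by \<open>continuous_measurable_pair\<close>.
\<close>

lemma solution_integral_step:
  fixes \<mu> :: "nat \<Rightarrow> 'a::{topological_group_add, t2_space} measure"
  assumes cpt: "compact (UNIV :: 'a set)" and P: "P \<in> solutions \<mu>"
    and g: "continuous_on UNIV (g :: _ \<Rightarrow> real)" and dep: "\<And>x y. (\<And>j. k \<le> j \<Longrightarrow> x j = y j) \<Longrightarrow> g x = g y"
  shows "(\<integral>x. g x \<partial>P) = (\<integral>x. (\<integral>s. g (x(k := x (Suc k) + s)) \<partial>\<mu> k) \<partial>P)"
proof -
  note reg = solutionsD(1)[OF P]
  note [simp] = regular_probD[OF reg]
  interpret prob_space P by simp
  have cptX: "compact (UNIV :: (nat \<Rightarrow> 'a) set)"
    by (rule compact_UNIV_fun) (rule cpt)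
  define E :: "(nat \<Rightarrow> 'a) measure" where "E = (\<Pi>\<^sub>M i\<in>UNIV. borel)"
  \<comment> \<open>A retraction onto paths that are measurable with respect to the past: the coordinates up to \<open>k\<close>
    repeat the coordinate \<open>Suc k\<close>.\<close>
  define \<tau> :: "(nat \<Rightarrow> 'a) \<Rightarrow> nat \<Rightarrow> 'a" where "\<tau> x j = x (max j (Suc k))" for x j
  define F where "F p = g ((fst p)(k := fst p (Suc k) + snd p))" for p :: "(nat \<Rightarrow> 'a) \<times> 'a"
  have F: "continuous_on UNIV F"
    unfolding F_def[abs_def] using continuous_on_compose2[OF g continuous_on_extend] by simp
  have F_meas: "F \<in> borel_measurable (E \<Otimes>\<^sub>M borel)"
  proof (rule continuous_measurable_pair[OF cptX cpt F])
    fix x y :: "nat \<Rightarrow> 'a" assume "x \<noteq> y"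
    then obtain i where "x i \<noteq> y i" by blast
    from separate_points[OF cpt this]
    obtain u :: "'a \<Rightarrow> real" where u: "continuous_on UNIV u" "u (x i) \<noteq> u (y i)" .
    have "(\<lambda>z. u (z i)) \<in> borel_measurable E"
      unfolding E_def using borel_measurable_continuous_onI[OF u(1)] by measurable
    moreover have "continuous_on UNIV (\<lambda>z :: nat \<Rightarrow> 'a. u (z i))"
      by (rule continuous_on_compose2[OF u(1) continuous_on_product_coordinates]) simp
    ultimately have "continuous_on UNIV (\<lambda>z :: nat \<Rightarrow> 'a. u (z i)) \<and>
        (\<lambda>z. u (z i)) \<in> borel_measurable E \<and> u (x i) \<noteq> u (y i)"
      using u(2) by simp
    then show "\<exists>u :: _ \<Rightarrow> real. continuous_on UNIV u \<and> u \<in> borel_measurable E \<and> u x \<noteq> u y"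
      by (rule exI[of _ "\<lambda>z. u (z i)"])
  next
    fix x y :: 'a assume "x \<noteq> y"
    from separate_points[OF cpt this]
    obtain u :: "'a \<Rightarrow> real" where u: "continuous_on UNIV u" "u x \<noteq> u y" .
    with borel_measurable_continuous_onI[OF u(1)]
    show "\<exists>u :: 'a \<Rightarrow> real. continuous_on UNIV u \<and> u \<in> borel_measurable borel \<and> u x \<noteq> u y"
      by blast
  qed
  have \<tau>: "\<tau> \<in> measurable (sigma UNIV (past (Suc k))) E"
    unfolding E_def \<tau>_def[abs_def]
    by (rule measurable_PiM_single') (auto intro!: measurable_past_coordinate)
  have g_eq: "g x = F (\<tau> x, noise k x)" for x
    unfolding F_def \<tau>_def noise_def by (intro dep) (auto simp: add.assoc[symmetric])
  have "integrable P g"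
    by (rule continuous_integrable[OF cptX g finite_measure_axioms]) simp
  then have "(\<integral>x. g x \<partial>P) = (\<integral>x. (\<integral>s. F (\<tau> x, s) \<partial>\<mu> k) \<partial>P)"
    using solution_integral_noise[OF P \<tau> F_meas] by (simp flip: g_eq)
  also have "\<dots> = (\<integral>x. (\<integral>s. g (x(k := x (Suc k) + s)) \<partial>\<mu> k) \<partial>P)"
    unfolding F_def \<tau>_def by (intro Bochner_Integration.integral_cong refl dep) auto
  finally show ?thesis .
qed

lemma integral_resample:
  fixes \<mu> :: "nat \<Rightarrow> 'a::{topological_group_add, t2_space} measure"
  assumes cpt: "compact (UNIV :: 'a set)"
    and \<mu>: "\<And>n. prob_space (\<mu> n)" "\<And>n. sets (\<mu> n) = sets borel"
    and P: "P \<in> solutions \<mu>" and f: "continuous_on UNIV f"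
  shows "(\<integral>x. resample \<mu> k f x \<partial>P) = (\<integral>x. f x \<partial>P)"
proof (induction k)
  case (Suc k)
  have "(\<integral>x. resample \<mu> k f x \<partial>P) = (\<integral>x. resample \<mu> (Suc k) f x \<partial>P)"
    unfolding resample.simps
    by (rule solution_integral_step[OF cpt P continuous_on_resample[OF cpt \<mu> f]])
      (rule resample_cong)
  with Suc show ?case by simp
qed simp

text \<open>
  Functions of the past can be pulled out of the conditional expectation.
\<close>

lemma resample_mult:
  assumes "\<And>x y. (\<And>j. k \<le> j \<Longrightarrow> x j = y j) \<Longrightarrow> a x = a y"
  shows "resample \<mu> k (\<lambda>x. a x * f x) x = a x * resample \<mu> k f x"
  using assms
proof (induction k arbitrary: x)
  case 0
  show ?case by simp
next
  case (Suc k)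
  have a: "a x = a y" if "\<And>j. k \<le> j \<Longrightarrow> x j = y j" for x y
    by (rule Suc.prems) (simp add: that)
  have "resample \<mu> k (\<lambda>x. a x * f x) (x(k := x (Suc k) + s)) =
      a x * resample \<mu> k f (x(k := x (Suc k) + s))" for s
  proof -
    have "a (x(k := x (Suc k) + s)) = a x"
      by (rule Suc.prems) auto
    then show ?thesis
      by (simp only: Suc.IH[OF a])
  qed
  then show ?case by simp
qed

lemma integral_mult_resample:
  fixes \<mu> :: "nat \<Rightarrow> 'a::{topological_group_add, t2_space} measure"
  assumes cpt: "compact (UNIV :: 'a set)"
    and \<mu>: "\<And>n. prob_space (\<mu> n)" "\<And>n. sets (\<mu> n) = sets borel"
    and P: "P \<in> solutions \<mu>" and a: "continuous_on UNIV a" and f: "continuous_on UNIV f"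
    and dep: "\<And>x y. (\<And>j. k \<le> j \<Longrightarrow> x j = y j) \<Longrightarrow> a x = a y"
  shows "(\<integral>x. a x * f x \<partial>P) = (\<integral>x. a x * resample \<mu> k f x \<partial>P)"
proof -
  have "(\<integral>x. a x * f x \<partial>P) = (\<integral>x. resample \<mu> k (\<lambda>x. a x * f x) x \<partial>P)"
    by (rule integral_resample[OF cpt \<mu> P continuous_on_mult[OF a f], symmetric])
  also have "\<dots> = (\<integral>x. a x * resample \<mu> k f x \<partial>P)"
    by (intro Bochner_Integration.integral_cong refl resample_mult dep)
  finally show ?thesis .
qed

text \<open>
  Rebuilding two paths with the same noise preserves the relation \<open>x j = w + y j\<close>, since the noise
  is multiplied from the right. So if \<open>f\<close> and \<open>g\<close> are close on pairs related by \<open>w\<close>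
  in all coordinates up to \<open>k\<close>, then their conditional expectations are close at pairs
  related by \<open>w\<close> in the single coordinate \<open>k\<close>.
\<close>

lemma resample_close:
  fixes \<mu> :: "nat \<Rightarrow> 'a::{topological_group_add, t2_space} measure"
  assumes cpt: "compact (UNIV :: 'a set)"
    and \<mu>: "\<And>n. prob_space (\<mu> n)" "\<And>n. sets (\<mu> n) = sets borel"
    and f: "continuous_on UNIV f" and g: "continuous_on UNIV g"
    and close: "\<And>x y. (\<And>j. j \<le> k \<Longrightarrow> x j = w + y j) \<Longrightarrow> \<bar>f x - g y\<bar> \<le> e"
    and "x k = w + y k"
  shows "\<bar>resample \<mu> k f x - resample \<mu> k g y\<bar> \<le> e"
proof -
  have "\<bar>resample \<mu> m f x - resample \<mu> m g y\<bar> \<le> e"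
    if "m \<le> k" "\<And>j. m \<le> j \<Longrightarrow> j \<le> k \<Longrightarrow> x j = w + y j" for m x y
    using that
  proof (induction m arbitrary: x y)
    case 0
    then show ?case by (auto intro!: close)
  next
    case (Suc m)
    interpret prob_space "\<mu> m" by (rule \<mu>)
    have int: "integrable (\<mu> m) (\<lambda>s. resample \<mu> m h (z(m := z (Suc m) + s)))"
      if "continuous_on UNIV h" for h z
    proof (rule continuous_integrable[OF cpt _ finite_measure_axioms \<mu>(2)])
      have "continuous_on UNIV (\<lambda>s. z(m := z (Suc m) + s))"
        using continuous_on_compose2[OF continuous_on_extend[of m], of UNIV "\<lambda>s. (z, s)"]
        by (simp add: continuous_on_Pair)
      then show "continuous_on UNIV (\<lambda>s. resample \<mu> m h (z(m := z (Suc m) + s)))"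
        using continuous_on_compose2[OF continuous_on_resample[OF cpt \<mu> that]] by simp
    qed
    have "\<bar>resample \<mu> (Suc m) f x - resample \<mu> (Suc m) g y\<bar> =
      \<bar>\<integral>s. resample \<mu> m f (x(m := x (Suc m) + s)) - resample \<mu> m g (y(m := y (Suc m) + s)) \<partial>\<mu> m\<bar>"
      using int[OF f] int[OF g] by simp
    also have "\<dots> \<le> (\<integral>s. \<bar>resample \<mu> m f (x(m := x (Suc m) + s)) - resample \<mu> m g (y(m := y (Suc m) + s))\<bar> \<partial>\<mu> m)"
      by (rule integral_abs_bound)
    also have "\<dots> \<le> (\<integral>s. e \<partial>\<mu> m)"
    proof (intro integral_mono)
      fix s
      show "\<bar>resample \<mu> m f (x(m := x (Suc m) + s)) - resample \<mu> m g (y(m := y (Suc m) + s))\<bar> \<le> e"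
        using Suc.prems by (intro Suc.IH) (auto simp: add.assoc)
    qed (use int[OF f] int[OF g] in auto)
    also have "\<dots> = e"
      by (simp add: prob_space)
    finally show ?case .
  qed
  from this[of k x y] assms(7) show ?thesis by auto
qed

section \<open>Extremal solutions forget the remote past\<close>

text \<open>
  By Tychonoff's theorem the points \<open>\<lambda>s. s k\<close> of the cube \<open>[0, 1]\<close> to the power of all functions
  \<open>s\<close> have a cluster point along \<open>V\<close>; the filter of those \<open>k\<close> whose points come near it makes all
  functions with values in \<open>[0, 1]\<close> converge simultaneously.
\<close>

lemma generalized_limit:
  fixes V :: "'k filter"
  assumes "V \<noteq> bot"
  obtains U where "U \<le> V" "U \<noteq> bot"
    "\<And>s :: 'k \<Rightarrow> real. (\<And>k. 0 \<le> s k \<and> s k \<le> 1) \<Longrightarrow> (s \<longlongrightarrow> Lim U s) U"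
proof -
  define p :: "'k \<Rightarrow> ('k \<Rightarrow> real) \<Rightarrow> real" where "p k s = max 0 (min 1 (s k))" for k s
  define K :: "(('k \<Rightarrow> real) \<Rightarrow> real) set" where "K = (\<Pi>\<^sub>E s\<in>UNIV. {0..1})"
  have "compactin (product_topology (\<lambda>_. euclidean) UNIV) K"
    unfolding K_def compactin_PiE by simp
  then have "compact K"
    by (simp only: euclidean_product_topology compactin_euclidean_iff)
  moreover have "filtermap p V \<noteq> bot"
    using assms by (simp add: filtermap_bot_iff)
  moreover have "eventually (\<lambda>f. f \<in> K) (filtermap p V)"
    unfolding eventually_filtermap by (rule always_eventually) (auto simp: K_def p_def)
  ultimately obtain L where L: "inf (nhds L) (filtermap p V) \<noteq> bot"
    unfolding compact_filter by blast
  define U where "U = inf V (filtercomap p (nhds L))"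
  have "U \<noteq> bot"
  proof
    assume "U = bot"
    then obtain Q R where QR: "eventually Q V" "eventually R (nhds L)" "\<And>k. Q k \<Longrightarrow> R (p k) \<Longrightarrow> False"
      unfolding U_def trivial_limit_def eventually_inf eventually_filtercomap by blast
    have "eventually (\<lambda>f. \<not> R f) (filtermap p V)"
      unfolding eventually_filtermap by (rule eventually_mono[OF QR(1)]) (use QR(3) in blast)
    with QR(2) have "inf (nhds L) (filtermap p V) = bot"
      unfolding trivial_limit_def eventually_inf by blast
    with L show False ..
  qed
  moreover have "(s \<longlongrightarrow> Lim U s) U" if s: "\<And>k. 0 \<le> s k \<and> s k \<le> 1" for s :: "'k \<Rightarrow> real"
  proof -
    have "filterlim p (nhds L) U"
      unfolding filterlim_iff_le_filtercomap U_def by simp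
    then have "((\<lambda>k. p k s) \<longlongrightarrow> L s) U"
      using continuous_on_tendsto_compose[OF continuous_on_product_coordinates] by fastforce
    moreover have "(\<lambda>k. p k s) = s"
      using s by (auto simp: p_def)
    ultimately show ?thesis
      using tendsto_Lim[OF \<open>U \<noteq> bot\<close>] by metis
  qed
  moreover have "U \<le> V"
    by (simp add: U_def)
  ultimately show thesis
    using that by blast
qed

text \<open>
  The setwise limit \<open>q\<close> of measures with densities \<open>\<phi> k \<le> 1\<close> with respect to \<open>P\<close> is finitely additive and
  dominated by \<open>P\<close>, hence continuous at the empty set, hence a measure. It satisfies the
  equation of the noise at every time because \<open>\<phi> k\<close> belongs to the past of that time as soon
  as \<open>k\<close> is large.
\<close>

lemma limit_density_solution:
  fixes \<mu> :: "nat \<Rightarrow> 'a::{topological_group_add, t2_space} measure"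
  assumes \<mu>: "\<And>n. prob_space (\<mu> n)" "\<And>n. sets (\<mu> n) = sets borel"
    and P: "P \<in> solutions \<mu>"
    and \<phi>: "\<And>k. \<phi> k \<in> borel_measurable (sigma UNIV (past k))"
    and \<phi>01: "\<And>k x. 0 \<le> \<phi> k x" "\<And>k x. \<phi> k x \<le> 1"
    and U: "U \<le> sequentially" "U \<noteq> bot"
    and q: "\<And>A. A \<in> sets borel \<Longrightarrow> ((\<lambda>k. \<integral>x. \<phi> k x * indicator A x \<partial>P) \<longlongrightarrow> q A) U"
    and pos: "0 < q UNIV"
  obtains Q where "Q \<in> solutions \<mu>" "\<And>A. A \<in> sets borel \<Longrightarrow> measure Q A = q A / q UNIV"
proof -
  note reg = solutionsD(1)[OF P]
  note [simp] = regular_probD[OF reg]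
  interpret prob_space P by simp
  interpret B: sigma_algebra UNIV "sets (borel :: (nat \<Rightarrow> 'a) measure)"
    using sets.sigma_algebra_axioms[of "borel :: (nat \<Rightarrow> 'a) measure"] by simp
  have \<phi>_meas: "\<phi> k \<in> borel_measurable P" for k
    using measurable_past_imp_borel[OF \<phi>] by simp
  have [simp]: "(\<lambda>x. \<phi> k x * indicator A x) \<in> borel_measurable P" if "A \<in> sets borel" for k A
    by (rule borel_measurable_times[OF \<phi>_meas borel_measurable_indicator]) (simp add: that)
  have int: "integrable P (\<lambda>x. \<phi> k x * indicator A x)" if "A \<in> sets borel" for k A
    using that \<phi>01 by (intro integrable_const_bound[where B = 1]) (auto split: split_indicator)
  have q_nonneg: "0 \<le> q A" if "A \<in> sets borel" for A
    by (rule tendsto_lowerbound[OF q[OF that] _ U(2)])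
      (auto intro!: always_eventually integral_nonneg_AE simp: \<phi>01)
  have q_le: "q A \<le> measure P A" if "A \<in> sets borel" for A
  proof (rule tendsto_upperbound[OF q[OF that] _ U(2)], intro always_eventually allI)
    fix k
    have "(\<integral>x. \<phi> k x * indicator A x \<partial>P) \<le> (\<integral>x. indicator A x \<partial>P)"
      using int that \<phi>01 by (intro integral_mono) (auto simp: emeasure_eq_measure split: split_indicator)
    then show "(\<integral>x. \<phi> k x * indicator A x \<partial>P) \<le> measure P A"
      by simp
  qed
  have q_add: "q (A \<union> A') = q A + q A'"
    if "A \<in> sets borel" "A' \<in> sets borel" "A \<inter> A' = {}" for A A'
  proof (rule tendsto_unique[OF U(2) q])
    have "(\<integral>x. \<phi> k x * indicator (A \<union> A') x \<partial>P) =
        (\<integral>x. \<phi> k x * indicator A x \<partial>P) + (\<integral>x. \<phi> k x * indicator A' x \<partial>P)" for k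
    proof -
      have "(\<lambda>x. \<phi> k x * indicator (A \<union> A') x) =
          (\<lambda>x. \<phi> k x * indicator A x + \<phi> k x * indicator A' x)"
        using that(3) by (auto simp: fun_eq_iff split: split_indicator)
      then show ?thesis
        using int[OF that(1)] int[OF that(2)] by simp
    qed
    then show "((\<lambda>k. \<integral>x. \<phi> k x * indicator (A \<union> A') x \<partial>P) \<longlongrightarrow> q A + q A') U"
      using tendsto_add[OF q q, OF that(1,2)] by simp
  qed (use that in auto)
  have q_empty: "q {} = 0"
    using q_add[of "{}" "{}"] by simp
  define f where "f A = ennreal (q A / q UNIV)" for A
  define Q :: "(nat \<Rightarrow> 'a) measure" where "Q = measure_of UNIV (sets borel) f"
  have f_pos: "positive (sets borel) f"
    by (simp add: positive_def f_def q_empty)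
  have f_ca: "countably_additive (sets borel) f"
  proof (rule B.empty_continuous_imp_countably_additive[OF f_pos])
    show "additive (sets borel) f"
      using pos q_nonneg
      by (auto simp: additive_def f_def q_add add_divide_distrib intro!: ennreal_plus)
    fix A :: "nat \<Rightarrow> (nat \<Rightarrow> 'a) set"
    assume A: "range A \<subseteq> sets borel" "decseq A" "(\<Inter>i. A i) = {}"
    have "(\<lambda>i. measure P (A i)) \<longlonglongrightarrow> 0"
      using finite_Lim_measure_decseq[of A] A by simp
    then have "(\<lambda>i. q (A i)) \<longlonglongrightarrow> 0"
      by (rule tendsto_sandwich[OF always_eventually always_eventually tendsto_const, rotated 2])
        (use A q_nonneg q_le in auto)
    then have "(\<lambda>i. q (A i) / q UNIV) \<longlonglongrightarrow> 0 / q UNIV"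
      by (rule tendsto_divide) (use pos in auto)
    then show "(\<lambda>i. f (A i)) \<longlonglongrightarrow> 0"
      unfolding f_def using tendsto_ennrealI by fastforce
  qed (simp add: f_def)
  have sets_Q [simp]: "sets Q = sets borel"
    unfolding Q_def using B.sets_measure_of_eq by simp
  have em_Q: "emeasure Q A = f A" if "A \<in> sets borel" for A
    unfolding Q_def by (rule emeasure_measure_of_sigma[OF B.sigma_algebra_axioms f_pos f_ca that])
  have Q: "measure Q A = q A / q UNIV" if "A \<in> sets borel" for A
    using em_Q[OF that] q_nonneg[OF that] pos by (simp add: measure_def f_def)
  have space_Q: "space Q = UNIV"
    using sets_eq_imp_space_eq[OF sets_Q] by simp
  have prob_Q: "prob_space Q"
    by (rule prob_spaceI) (use pos in \<open>simp add: space_Q em_Q f_def\<close>)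
  have noise: "q (noise n -` B \<inter> C) = measure (\<mu> n) B * q C"
    if B: "B \<in> sets borel" and C: "C \<in> past (Suc n)" for n B C
  proof (rule tendsto_unique[OF U(2) q])
    have C': "C \<in> sets borel"
      using C past_subset_borel by blast
    then show "noise n -` B \<inter> C \<in> sets borel"
      using measurable_sets[OF noise_measurable[of P n] B] by auto
    have "(\<integral>x. \<phi> k x * indicator (noise n -` B \<inter> C) x \<partial>P) =
        measure (\<mu> n) B * (\<integral>x. \<phi> k x * indicator C x \<partial>P)" if "Suc n \<le> k" for k
    proof -
      have [measurable]: "\<phi> k \<in> borel_measurable (sigma UNIV (past (Suc n)))"
        using measurable_pastI[OF \<phi> that] .
      have [measurable]: "C \<in> sets (sigma UNIV (past (Suc n)))"
        using C by (simp add: sets_past)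
      note [measurable] = B
      have *: "\<phi> k x * indicator (noise n -` B \<inter> C) x =
          (\<phi> k x * indicator C x) * indicator B (noise n x)" for x
        by (auto split: split_indicator)
      have "integrable P (\<lambda>x. \<phi> k x * indicator (noise n -` B \<inter> C) x)"
        by (rule int) fact
      then have "(\<integral>x. \<phi> k x * indicator (noise n -` B \<inter> C) x \<partial>P) =
          (\<integral>x. (\<integral>s. (\<phi> k x * indicator C x) * indicator B s \<partial>\<mu> n) \<partial>P)"
        unfolding *
        using solution_integral_noise[OF P, of "\<lambda>x. \<phi> k x * indicator C x" n borel
            "\<lambda>p. fst p * indicator B (snd p)"] by simp
      also have "\<dots> = measure (\<mu> n) B * (\<integral>x. \<phi> k x * indicator C x \<partial>P)"
        using sets_eq_imp_space_eq[OF \<mu>(2)[of n]] by (simp add: mult.commute)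
      finally show ?thesis .
    qed
    then have "eventually (\<lambda>k. (\<integral>x. \<phi> k x * indicator (noise n -` B \<inter> C) x \<partial>P) =
        measure (\<mu> n) B * (\<integral>x. \<phi> k x * indicator C x \<partial>P)) U"
      using eventually_ge_at_top[of "Suc n"] by (intro filter_leD[OF U(1)]) (rule eventually_mono)
    then show "((\<lambda>k. \<integral>x. \<phi> k x * indicator (noise n -` B \<inter> C) x \<partial>P) \<longlongrightarrow> measure (\<mu> n) B * q C) U"
      using tendsto_mult[OF tendsto_const q[OF C']] by (subst tendsto_cong) assumption
  qed
  have "regular_prob Q"
  proof (rule regular_prob_dominated[OF reg prob_Q sets_Q])
    fix A :: "(nat \<Rightarrow> 'a) set" assume "A \<in> sets borel"
    then show "measure Q A \<le> 1 / q UNIV * measure P A"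
      using q_le[of A] pos by (simp add: Q divide_right_mono)
  qed
  moreover have "measure Q (noise n -` B \<inter> C) = measure (\<mu> n) B * measure Q C"
    if "B \<in> sets borel" "C \<in> past (Suc n)" for n B C
  proof -
    have "C \<in> sets borel"
      using that past_subset_borel by blast
    moreover have "noise n -` B \<inter> C \<in> sets borel"
      using measurable_sets[OF noise_measurable[of P n] that(1)] \<open>C \<in> sets borel\<close> by auto
    ultimately show ?thesis
      using noise[OF that] by (simp add: Q)
  qed
  ultimately have "Q \<in> solutions \<mu>"
    by (simp add: solutions_iff[OF \<mu>])
  then show thesis
    using Q that by blast
qed

text \<open>
  The limits belonging to \<open>\<phi> k\<close> and to \<open>1 - \<phi> k\<close>, normalized, are two solutions of which \<open>P\<close> is a convex
  combination. By extremality they coincide with \<open>P\<close>.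
\<close>

lemma extremal_limit_density:
  fixes \<mu> :: "nat \<Rightarrow> 'a::{topological_group_add, t2_space} measure"
  assumes \<mu>: "\<And>n. prob_space (\<mu> n)" "\<And>n. sets (\<mu> n) = sets borel"
    and P: "P \<in> extremal_solutions \<mu>"
    and \<phi>: "\<And>k. \<phi> k \<in> borel_measurable (sigma UNIV (past k))"
    and \<phi>01: "\<And>k x. 0 \<le> \<phi> k x" "\<And>k x. \<phi> k x \<le> 1"
    and U: "U \<le> sequentially" "U \<noteq> bot"
    and q: "\<And>A. A \<in> sets borel \<Longrightarrow> ((\<lambda>k. \<integral>x. \<phi> k x * indicator A x \<partial>P) \<longlongrightarrow> q A) U"
    and A: "A \<in> sets borel"
  shows "q A = q UNIV * measure P A"
proof -
  have sol: "P \<in> solutions \<mu>"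
    using P by (simp add: extremal_solutions_def)
  note reg = solutionsD(1)[OF sol]
  note [simp] = regular_probD[OF reg]
  interpret prob_space P by simp
  have \<phi>_meas: "\<phi> k \<in> borel_measurable P" for k
    using measurable_past_imp_borel[OF \<phi>] by simp
  have [simp]: "(\<lambda>x. \<phi> k x * indicator A x) \<in> borel_measurable P" if "A \<in> sets borel" for k A
    by (rule borel_measurable_times[OF \<phi>_meas borel_measurable_indicator]) (simp add: that)
  define q' where "q' A = measure P A - q A" for A
  have q': "((\<lambda>k. \<integral>x. (1 - \<phi> k x) * indicator A x \<partial>P) \<longlongrightarrow> q' A) U" if "A \<in> sets borel" for A
  proof -
    have "(\<integral>x. (1 - \<phi> k x) * indicator A x \<partial>P) =
        measure P A - (\<integral>x. \<phi> k x * indicator A x \<partial>P)" for k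
    proof -
      have "integrable P (\<lambda>x. \<phi> k x * indicator A x)"
        using that \<phi>01 by (intro integrable_const_bound[where B = 1]) (auto split: split_indicator)
      then show ?thesis
        using that by (simp add: left_diff_distrib emeasure_eq_measure)
    qed
    then show ?thesis
      unfolding q'_def using tendsto_diff[OF tendsto_const q[OF that]] by simp
  qed
  have bounds: "0 \<le> q A" "0 \<le> q' A" if "A \<in> sets borel" for A
    by (rule tendsto_lowerbound[OF q[OF that] _ U(2)] tendsto_lowerbound[OF q'[OF that] _ U(2)];
      auto intro!: always_eventually integral_nonneg_AE simp: \<phi>01)+
  have mono: "q A \<le> q UNIV" "q' A \<le> q' UNIV"
  proof -
    have "(\<integral>x. \<phi> k x * indicator A x \<partial>P) \<le> (\<integral>x. \<phi> k x * indicator UNIV x \<partial>P)"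
      "(\<integral>x. (1 - \<phi> k x) * indicator A x \<partial>P) \<le> (\<integral>x. (1 - \<phi> k x) * indicator UNIV x \<partial>P)" for k
      using A \<phi>01 \<phi>_meas
      by (auto intro!: integral_mono integrable_const_bound[where B = 1] borel_measurable_diff
          borel_measurable_times borel_measurable_indicator split: split_indicator)
    then show "q A \<le> q UNIV" "q' A \<le> q' UNIV"
      by (auto intro!: tendsto_le[OF U(2) q q] tendsto_le[OF U(2) q' q'] always_eventually A)
  qed
  have one: "q UNIV + q' UNIV = 1"
    using prob_space by (simp add: q'_def)
  \<comment> \<open>If one of the two limits has no mass, it cannot be normalized, but then it vanishes on every set.\<close>
  consider "q UNIV = 0" | "q' UNIV = 0" | "0 < q UNIV" "0 < q' UNIV"
    using bounds[of UNIV] by fastforce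
  then show ?thesis
  proof cases
    case 1
    then show ?thesis using mono bounds[OF A] by simp
  next
    case 2
    then show ?thesis using mono bounds[OF A] one by (simp add: q'_def)
  next
    case 3
    obtain Q where Q: "Q \<in> solutions \<mu>" "\<And>A. A \<in> sets borel \<Longrightarrow> measure Q A = q A / q UNIV"
      using limit_density_solution[OF \<mu> sol \<phi> \<phi>01 U q 3(1)] by blast
    obtain R where R: "R \<in> solutions \<mu>" "\<And>A. A \<in> sets borel \<Longrightarrow> measure R A = q' A / q' UNIV"
      using limit_density_solution[OF \<mu> sol _ _ _ U q' 3(2)] \<phi> \<phi>01 by (auto simp: borel_measurable_diff)
    have dec: "measure P A = (1 - q' UNIV) * measure Q A + q' UNIV * measure R A" if "A \<in> sets borel" for A
      using 3 one by (simp add: Q(2)[OF that] R(2)[OF that]) (simp add: q'_def field_simps)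
    have "Q = R"
    proof (rule ccontr)
      assume "Q \<noteq> R"
      moreover have "0 < q' UNIV" "q' UNIV < 1"
        using 3 one by auto
      ultimately show False
        using P Q(1) R(1) dec unfolding extremal_solutions_def by blast
    qed
    then have "measure P A = measure Q A"
      using dec[OF A] by (simp add: algebra_simps)
    then show ?thesis
      using 3 Q(2)[OF A] by simp
  qed
qed

text \<open>
  If the correlations did not tend to zero, they would stay away from zero along a finer filter on
  which all expectations converge, contrary to \<open>extremal_limit_density\<close>.
\<close>

lemma extremal_remote_past_mixing_set:
  fixes \<mu> :: "nat \<Rightarrow> 'a::{topological_group_add, t2_space} measure"
  assumes \<mu>: "\<And>n. prob_space (\<mu> n)" "\<And>n. sets (\<mu> n) = sets borel"
    and P: "P \<in> extremal_solutions \<mu>"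
    and \<phi>: "\<And>k. \<phi> k \<in> borel_measurable (sigma UNIV (past k))"
    and \<phi>01: "\<And>k x. 0 \<le> \<phi> k x" "\<And>k x. \<phi> k x \<le> 1"
    and A: "A \<in> sets borel"
  shows "(\<lambda>k. (\<integral>x. \<phi> k x * indicator A x \<partial>P) - (\<integral>x. \<phi> k x \<partial>P) * measure P A) \<longlonglongrightarrow> 0"
    (is "?d \<longlonglongrightarrow> 0")
proof (rule ccontr)
  have sol: "P \<in> solutions \<mu>"
    using P by (simp add: extremal_solutions_def)
  note reg = solutionsD(1)[OF sol]
  note [simp] = regular_probD[OF reg]
  interpret prob_space P by simp
  have \<phi>_meas: "\<phi> k \<in> borel_measurable P" for k
    using measurable_past_imp_borel[OF \<phi>] by simp
  have [simp]: "(\<lambda>x. \<phi> k x * indicator A x) \<in> borel_measurable P" if "A \<in> sets borel" for k A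
    by (rule borel_measurable_times[OF \<phi>_meas borel_measurable_indicator]) (simp add: that)
  assume "\<not> ?d \<longlonglongrightarrow> 0"
  then obtain e where "0 < e" and e: "\<not> eventually (\<lambda>k. \<bar>?d k\<bar> < e) sequentially"
    by (auto simp: tendsto_iff)
  define V where "V = inf sequentially (principal {k. e \<le> \<bar>?d k\<bar>})"
  have "V \<noteq> bot"
    using e unfolding V_def trivial_limit_def eventually_inf_principal by (simp add: not_le)
  then obtain U where U: "U \<le> V" "U \<noteq> bot"
    "\<And>s :: nat \<Rightarrow> real. (\<And>k. 0 \<le> s k \<and> s k \<le> 1) \<Longrightarrow> (s \<longlongrightarrow> Lim U s) U"
    using generalized_limit by blast
  have "U \<le> sequentially"
    using U(1) by (auto simp: V_def)
  define q where "q A = Lim U (\<lambda>k. \<integral>x. \<phi> k x * indicator A x \<partial>P)" for A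
  have q: "((\<lambda>k. \<integral>x. \<phi> k x * indicator A x \<partial>P) \<longlongrightarrow> q A) U" if "A \<in> sets borel" for A
    unfolding q_def
  proof (rule U(3), intro conjI)
    fix k
    show "0 \<le> (\<integral>x. \<phi> k x * indicator A x \<partial>P)"
      by (intro integral_nonneg_AE) (simp add: \<phi>01)
    have "(\<integral>x. \<phi> k x * indicator A x \<partial>P) \<le> (\<integral>x. 1 \<partial>P)"
      using that \<phi>01
      by (intro integral_mono integrable_const_bound[where B = 1]) (auto split: split_indicator)
    then show "(\<integral>x. \<phi> k x * indicator A x \<partial>P) \<le> 1"
      using prob_space by simp
  qed
  have "q A = q UNIV * measure P A"
    by (rule extremal_limit_density[OF \<mu> P \<phi> \<phi>01 \<open>U \<le> sequentially\<close> U(2) q A])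
  then have "(?d \<longlongrightarrow> 0) U"
    using tendsto_diff[OF q[OF A] tendsto_mult_right[OF q[of UNIV], of "measure P A"]] by simp
  then have "eventually (\<lambda>k. \<bar>?d k\<bar> < e) U"
    using \<open>0 < e\<close> by (auto simp: tendsto_iff)
  moreover have "eventually (\<lambda>k. e \<le> \<bar>?d k\<bar>) U"
    using U(1) by (auto simp: V_def le_inf_iff le_principal)
  ultimately have "eventually (\<lambda>k. False) U"
    by (rule eventually_elim2) simp
  then show False
    using U(2) by (simp add: trivial_limit_def)
qed

text \<open>
  Both terms are continuous in \<open>f\<close> with respect to the mean, uniformly in \<open>k\<close>, so the case of indicator
  functions suffices.
\<close>

lemma extremal_remote_past_mixing:
  fixes \<mu> :: "nat \<Rightarrow> 'a::{topological_group_add, t2_space} measure"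
  assumes \<mu>: "\<And>n. prob_space (\<mu> n)" "\<And>n. sets (\<mu> n) = sets borel"
    and P: "P \<in> extremal_solutions \<mu>"
    and \<phi>: "\<And>k. \<phi> k \<in> borel_measurable (sigma UNIV (past k))"
    and \<phi>01: "\<And>k x. 0 \<le> \<phi> k x" "\<And>k x. \<phi> k x \<le> 1"
    and f: "integrable P f"
  shows "(\<lambda>k. (\<integral>x. \<phi> k x * f x \<partial>P) - (\<integral>x. \<phi> k x \<partial>P) * (\<integral>x. f x \<partial>P)) \<longlonglongrightarrow> (0 :: real)"
proof -
  have sol: "P \<in> solutions \<mu>"
    using P by (simp add: extremal_solutions_def)
  note reg = solutionsD(1)[OF sol]
  note [simp] = regular_probD[OF reg]
  interpret prob_space P by simp
  have \<phi>_meas: "\<phi> k \<in> borel_measurable P" for k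
    using measurable_past_imp_borel[OF \<phi>] by simp
  have int: "integrable P (\<lambda>x. \<phi> k x * g x)" if "integrable P g" for k and g :: "_ \<Rightarrow> real"
    using that by (rule Bochner_Integration.integrable_bound)
      (use that \<phi>01 \<phi>_meas in \<open>auto simp: abs_mult mult_left_le_one_le intro!: borel_measurable_times\<close>)
  have int\<phi>: "integrable P (\<phi> k)" for k
    using int[of "\<lambda>_. 1"] by simp
  have \<phi>_le: "\<bar>\<integral>x. \<phi> k x \<partial>P\<bar> \<le> 1" for k
  proof -
    have "0 \<le> (\<integral>x. \<phi> k x \<partial>P)"
      using \<phi>01 by (intro integral_nonneg_AE) simp
    moreover have "(\<integral>x. \<phi> k x \<partial>P) \<le> (\<integral>x. 1 \<partial>P)"
      using \<phi>01 int\<phi> by (intro integral_mono) auto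
    ultimately show ?thesis
      using prob_space by simp
  qed
  define d :: "((nat \<Rightarrow> 'a) \<Rightarrow> real) \<Rightarrow> nat \<Rightarrow> real" where
    "d g k = (\<integral>x. \<phi> k x * g x \<partial>P) - (\<integral>x. \<phi> k x \<partial>P) * (\<integral>x. g x \<partial>P)" for g k
  have d_add: "d (\<lambda>x. g x + h x) k = d g k + d h k" if "integrable P g" "integrable P h" for g h k
    using that int by (simp add: d_def algebra_simps)
  have d_le: "\<bar>d g k\<bar> \<le> 2 * (\<integral>x. \<bar>g x\<bar> \<partial>P)" if g: "integrable P g" for g k
  proof -
    have "\<bar>\<integral>x. \<phi> k x * g x \<partial>P\<bar> \<le> (\<integral>x. \<bar>\<phi> k x * g x\<bar> \<partial>P)"
      by (rule integral_abs_bound)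
    also have "\<dots> \<le> (\<integral>x. \<bar>g x\<bar> \<partial>P)"
      using g int[OF g] int[of "\<lambda>x. \<bar>g x\<bar>"] \<phi>01
      by (intro integral_mono) (auto simp: abs_mult mult_left_le_one_le)
    finally have 1: "\<bar>\<integral>x. \<phi> k x * g x \<partial>P\<bar> \<le> (\<integral>x. \<bar>g x\<bar> \<partial>P)" .
    have "\<bar>\<integral>x. \<phi> k x \<partial>P\<bar> * \<bar>\<integral>x. g x \<partial>P\<bar> \<le> 1 * (\<integral>x. \<bar>g x\<bar> \<partial>P)"
      by (intro mult_mono \<phi>_le integral_abs_bound) auto
    with 1 show ?thesis
      unfolding d_def abs_mult[symmetric] by linarith
  qed
  have "d f \<longlonglongrightarrow> 0"
    using f
  proof (induction rule: integrable_induct)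
    case (base A c)
    have "d (\<lambda>x. indicator A x *\<^sub>R c) k =
        ((\<integral>x. \<phi> k x * indicator A x \<partial>P) - (\<integral>x. \<phi> k x \<partial>P) * measure P A) * c" for k
      using base by (simp add: d_def algebra_simps)
    then show ?case
      using tendsto_mult_left_zero[OF extremal_remote_past_mixing_set[OF \<mu> P \<phi> \<phi>01, of A]] base
      by simp
  next
    case (add f g)
    then show ?case
      using tendsto_add[OF add.IH] by (simp add: d_add)
  next
    case (lim f s)
    show ?case
    proof (rule tendstoI)
      fix e :: real assume "0 < e"
      have "(\<lambda>i. \<integral>x. \<bar>f x - s i x\<bar> \<partial>P) \<longlonglongrightarrow> (\<integral>x. 0 \<partial>P)"
      proof (rule integral_dominated_convergence[where w = "\<lambda>x. 3 * \<bar>f x\<bar>"])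
        show "AE x in P. (\<lambda>i. \<bar>f x - s i x\<bar>) \<longlonglongrightarrow> 0"
        proof (rule AE_I2)
          fix x assume "x \<in> space P"
          then have "(\<lambda>i. f x - s i x) \<longlonglongrightarrow> f x - f x"
            by (intro tendsto_diff tendsto_const lim.hyps)
          then show "(\<lambda>i. \<bar>f x - s i x\<bar>) \<longlonglongrightarrow> 0"
            using tendsto_rabs_zero by simp
        qed
        \<comment> \<open>The approximating functions satisfy \<open>\<bar>s i x\<bar> \<le> 2 * \<bar>f x\<bar>\<close>.\<close>
        show "AE x in P. norm \<bar>f x - s i x\<bar> \<le> 3 * \<bar>f x\<bar>" for i
        proof (rule AE_I2)
          fix x assume "x \<in> space P"
          then show "norm \<bar>f x - s i x\<bar> \<le> 3 * \<bar>f x\<bar>"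
            using lim.hyps(3)[of x i] by simp
        qed
      qed (use lim.hyps in auto)
      then have "eventually (\<lambda>i. (\<integral>x. \<bar>f x - s i x\<bar> \<partial>P) < e / 4) sequentially"
        using \<open>0 < e\<close> by (intro order_tendstoD) auto
      then obtain i where i: "(\<integral>x. \<bar>f x - s i x\<bar> \<partial>P) < e / 4"
        by (auto simp: eventually_sequentially)
      have "eventually (\<lambda>k. \<bar>d (s i) k\<bar> < e / 2) sequentially"
        using tendstoD[OF lim.IH[of i], of "e / 2"] \<open>0 < e\<close> by simp
      then show "eventually (\<lambda>k. dist (d f k) 0 < e) sequentially"
      proof eventually_elim
        case (elim k)
        have "d f k = d (s i) k + d (\<lambda>x. f x - s i x) k"
          using d_add[of "s i" "\<lambda>x. f x - s i x" k] lim.hyps(1,4) by simp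
        moreover have "\<bar>d (\<lambda>x. f x - s i x) k\<bar> \<le> 2 * (\<integral>x. \<bar>f x - s i x\<bar> \<partial>P)"
          using lim.hyps(1,4) by (intro d_le) auto
        ultimately show ?case
          using i elim by simp
      qed
    qed
  qed
  then show ?thesis
    by (simp add: d_def[abs_def])
qed

section \<open>Transitivity of the action on extremal solutions\<close>

text \<open>
  These are the weights to which mixing will be applied: when two independent paths are weighted
  with a function of their states at time \<open>-k\<close>, the conditional expectation of the weight given one of the
  paths depends only on the past of this path.
\<close>

lemma averaged_weight:
  fixes H :: "'a::t2_space \<Rightarrow> 'a \<Rightarrow> real" and M :: "(nat \<Rightarrow> 'a) measure"
  assumes cpt: "compact (UNIV :: 'a set)" and H: "continuous_on UNIV (\<lambda>(s, t). H s t)"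
    and H01: "\<And>s t. 0 \<le> H s t" "\<And>s t. H s t \<le> 1"
    and M: "regular_prob M"
  shows "(\<lambda>x. \<integral>y. H (x k) (y k) \<partial>M) \<in> borel_measurable (sigma UNIV (past k))"
    and "0 \<le> (\<integral>y. H s (y k) \<partial>M)" and "(\<integral>y. H s (y k) \<partial>M) \<le> 1"
proof -
  interpret prob_space M using regular_probD[OF M] by simp
  have cptX: "compact (UNIV :: (nat \<Rightarrow> 'a) set)"
    by (rule compact_UNIV_fun) fact
  have "continuous_on UNIV (\<lambda>p :: 'a \<times> (nat \<Rightarrow> 'a). snd p k)"
    by (rule continuous_on_compose2[OF continuous_on_product_coordinates continuous_on_snd[OF continuous_on_id]]) simp
  then have "continuous_on UNIV (\<lambda>p :: 'a \<times> (nat \<Rightarrow> 'a). (fst p, snd p k))"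
    by (intro continuous_intros)
  then have c: "continuous_on UNIV (\<lambda>(s, y :: nat \<Rightarrow> 'a). H s (y k))"
    using continuous_on_compose2[OF H, of UNIV "\<lambda>p :: 'a \<times> (nat \<Rightarrow> 'a). (fst p, snd p k)"]
    by (simp add: case_prod_beta')
  have u: "continuous_on UNIV (\<lambda>s. \<integral>y. H s (y k) \<partial>M)"
    by (rule continuous_on_integral_parameter[OF cptX c]) (use regular_probD[OF M] in auto)
  show "(\<lambda>x. \<integral>y. H (x k) (y k) \<partial>M) \<in> borel_measurable (sigma UNIV (past k))"
    by (rule measurable_compose[OF measurable_past_coordinate[OF order_refl]
          borel_measurable_continuous_onI[OF u]])
  show "0 \<le> (\<integral>y. H s (y k) \<partial>M)"
    by (intro integral_nonneg_AE) (simp add: H01)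
  have "integrable M (\<lambda>y. H s (y k))"
  proof (rule continuous_integrable[OF cptX _ finite_measure_axioms])
    show "continuous_on UNIV (\<lambda>y. H s (y k))"
      using continuous_on_compose2[OF c, of UNIV "\<lambda>y. (s, y)"] by (simp add: continuous_on_Pair)
  qed (use regular_probD[OF M] in simp)
  then have "(\<integral>y. H s (y k) \<partial>M) \<le> (\<integral>y. 1 \<partial>M)"
    by (intro integral_mono) (auto simp: H01)
  then show "(\<integral>y. H s (y k) \<partial>M) \<le> 1"
    using prob_space by simp
qed

text \<open>
  A point near which the functionals \<open>c k\<close> do not lose all their mass. If every point had a function that
  is positive there and whose values under \<open>c k\<close> tend to zero, then by compactness a finite sum of
  these functions would be bounded below by a positive constant although its values tend to zero.
\<close>

lemma support_point:
  fixes c :: "nat \<Rightarrow> ('a::topological_space \<Rightarrow> real) \<Rightarrow> real"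
  assumes cpt: "compact (UNIV :: 'a set)"
    and c_sum: "\<And>k S h. finite S \<Longrightarrow> (\<And>z. z \<in> S \<Longrightarrow> continuous_on UNIV (h z)) \<Longrightarrow>
      c k (\<lambda>x. \<Sum>z\<in>S. h z x) = (\<Sum>z\<in>(S :: 'a set). c k (h z))"
    and c_lower: "\<And>k h d. continuous_on UNIV h \<Longrightarrow> (\<And>x. d \<le> h x) \<Longrightarrow> d \<le> c k h"
  obtains z where "\<And>h. continuous_on UNIV h \<Longrightarrow> (\<And>x. 0 \<le> h x) \<Longrightarrow> 0 < h z \<Longrightarrow> \<not> (\<lambda>k. c k h) \<longlonglongrightarrow> 0"
proof -
  have "\<exists>z. \<forall>h. continuous_on UNIV h \<and> (\<forall>x. 0 \<le> h x) \<and> 0 < h z \<longrightarrow> \<not> (\<lambda>k. c k h) \<longlonglongrightarrow> 0"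
  proof (rule ccontr)
    assume "\<not> ?thesis"
    then have "\<forall>z. \<exists>h. continuous_on UNIV h \<and> (\<forall>x. 0 \<le> h x) \<and> 0 < h z \<and> (\<lambda>k. c k h) \<longlonglongrightarrow> 0"
      by simp
    then obtain h where h: "\<And>z. continuous_on UNIV (h z)" "\<And>z x. 0 \<le> h z x" "\<And>z. 0 < h z z"
        "\<And>z. (\<lambda>k. c k (h z)) \<longlonglongrightarrow> 0"
      by metis
    have "open {x. 0 < h z x}" for z
      by (intro open_Collect_less continuous_on_const h)
    moreover have "UNIV \<subseteq> (\<Union>z. {x. 0 < h z x})"
      using h(3) by auto
    ultimately obtain S where S: "finite S" "UNIV \<subseteq> (\<Union>z\<in>S. {x. 0 < h z x})"
      using compactE_image[OF cpt, of UNIV "\<lambda>z. {x. 0 < h z x}"] by auto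
    define s where "s x = (\<Sum>z\<in>S. h z x)" for x
    have s: "continuous_on UNIV s"
      unfolding s_def[abs_def] by (intro continuous_on_sum h)
    have s_pos: "0 < s x" for x
    proof -
      obtain z where "z \<in> S" "0 < h z x"
        using S(2) by auto
      then show ?thesis
        unfolding s_def using S(1) h(2) by (intro sum_pos2) auto
    qed
    obtain m where m: "\<And>x. s m \<le> s x"
      using continuous_attains_inf[OF cpt _ s] by auto
    have "s m \<le> c k s" for k
      by (rule c_lower[OF s m])
    moreover have "(\<lambda>k. c k s) \<longlonglongrightarrow> (\<Sum>z\<in>S. 0)"
      unfolding s_def using c_sum[OF S(1) h(1)] tendsto_sum[of S, OF h(4)] by simp
    ultimately have "s m \<le> 0"
      by (intro tendsto_lowerbound[where f = "\<lambda>k. c k s"]) auto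
    with s_pos[of m] show False by simp
  qed
  with that show thesis by blast
qed

lemma continuous_on_ratio:
  fixes h :: "'a::topological_group_add \<Rightarrow> real"
  assumes h: "continuous_on UNIV h"
  shows "continuous_on UNIV (\<lambda>(x :: nat \<Rightarrow> 'a, y). h (x k - y k))"
    and "continuous_on UNIV (\<lambda>(y :: nat \<Rightarrow> 'a, x). h (x k - y k))"
    and "continuous_on UNIV (\<lambda>x. h (x k - z k))"
proof -
  have c: "continuous_on UNIV (\<lambda>p :: (nat \<Rightarrow> 'a) \<times> (nat \<Rightarrow> 'a). fst p k)"
    "continuous_on UNIV (\<lambda>p :: (nat \<Rightarrow> 'a) \<times> (nat \<Rightarrow> 'a). snd p k)"
    by (rule continuous_on_compose2[OF continuous_on_product_coordinates]; simp add: continuous_intros)+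
  show "continuous_on UNIV (\<lambda>(x :: nat \<Rightarrow> 'a, y). h (x k - y k))"
    "continuous_on UNIV (\<lambda>(y :: nat \<Rightarrow> 'a, x). h (x k - y k))"
    unfolding case_prod_beta'
    by (rule continuous_on_compose2[OF h continuous_on_diff[OF c(1,2)]]
        continuous_on_compose2[OF h continuous_on_diff[OF c(2,1)]]; simp)+
  show "continuous_on UNIV (\<lambda>x. h (x k - z k))"
    by (rule continuous_on_compose2[OF h]) (auto intro!: continuous_on_diff)
qed

text \<open>
  The coupling of \<open>P\<close> and \<open>P'\<close> by a common noise after time \<open>-k\<close>, written without the coupled
  law. The weight \<open>h (x k - y k)\<close> depends on the states at time \<open>-k\<close> only, so \<open>f\<close> and \<open>g\<close> can be
  replaced by their conditional expectations given the past of that time. Where the weight does not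
  vanish, these are compared by \<open>resample_close\<close>.
\<close>

lemma common_noise_estimate:
  fixes \<mu> :: "nat \<Rightarrow> 'a::{topological_group_add, t2_space} measure"
    and h :: "'a \<Rightarrow> real" and f g :: "(nat \<Rightarrow> 'a) \<Rightarrow> real"
  assumes cpt: "compact (UNIV :: 'a set)"
    and \<mu>: "\<And>n. prob_space (\<mu> n)" "\<And>n. sets (\<mu> n) = sets borel"
    and P: "P \<in> solutions \<mu>" and P': "P' \<in> solutions \<mu>"
    and h: "continuous_on UNIV h" "\<And>w. 0 \<le> h w"
    and f: "continuous_on UNIV f" and g: "continuous_on UNIV g"
    and close: "\<And>w x y. h w \<noteq> 0 \<Longrightarrow> (\<And>j. j \<le> k \<Longrightarrow> x j = w + y j) \<Longrightarrow> \<bar>f x - g y\<bar> \<le> e"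
  shows "\<bar>(\<integral>x. (\<integral>y. h (x k - y k) \<partial>P') * f x \<partial>P) - (\<integral>y. (\<integral>x. h (x k - y k) \<partial>P) * g y \<partial>P')\<bar>
    \<le> e * (\<integral>y. (\<integral>x. h (x k - y k) \<partial>P) \<partial>P')"
proof -
  note reg = solutionsD(1)[OF P] and reg' = solutionsD(1)[OF P']
  note [simp] = regular_probD[OF reg] regular_probD[OF reg']
  interpret P: prob_space P by simp
  interpret P': prob_space P' by simp
  have cptX: "compact (UNIV :: (nat \<Rightarrow> 'a) set)"
    by (rule compact_UNIV_fun) fact
  have intP: "integrable P u" and intP': "integrable P' u" if "continuous_on UNIV u" for u :: "_ \<Rightarrow> real"
    by (intro continuous_integrable[OF cptX that]; simp add: P.finite_measure_axioms P'.finite_measure_axioms)+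
  let ?f = "resample \<mu> k f" and ?g = "resample \<mu> k g"
  have cf: "continuous_on UNIV ?f" and cg: "continuous_on UNIV ?g"
    by (intro continuous_on_resample[OF cpt \<mu>] f g)+
  define \<phi> where "\<phi> y = (\<integral>x. h (x k - y k) \<partial>P)" for y :: "nat \<Rightarrow> 'a"
  have \<phi>_cont: "continuous_on UNIV \<phi>"
    unfolding \<phi>_def[abs_def]
    by (rule continuous_on_integral_parameter[OF cptX continuous_on_ratio(2)[OF h(1)]]) simp_all
  define I where "I y = (\<integral>x. h (x k - y k) * ?f x \<partial>P)" for y
  have I: "(\<integral>x. h (x k - y k) * f x \<partial>P) = I y" for y
    unfolding I_def
    by (intro integral_mult_resample[OF cpt \<mu> P] continuous_on_ratio(3)[OF h(1)] f) simp
  have I_cont: "continuous_on UNIV I"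
    unfolding I_def[abs_def]
  proof (rule continuous_on_integral_parameter[OF cptX])
    have "continuous_on UNIV (\<lambda>p :: (nat \<Rightarrow> 'a) \<times> (nat \<Rightarrow> 'a). ?f (snd p))"
      by (rule continuous_on_compose2[OF cf]) (simp_all add: continuous_intros)
    from continuous_on_mult[OF continuous_on_ratio(2)[OF h(1), of k] this]
    show "continuous_on UNIV (\<lambda>(y, x). h (x k - y k) * ?f x)"
      by (simp add: case_prod_beta')
  qed simp_all
  have "(\<integral>x. (\<integral>y. h (x k - y k) \<partial>P') * f x \<partial>P) = (\<integral>x. (\<integral>y. h (x k - y k) * f x \<partial>P') \<partial>P)"
    by simp
  also have "\<dots> = (\<integral>y. (\<integral>x. h (x k - y k) * f x \<partial>P) \<partial>P')"
  proof (rule Fubini_continuous[OF cptX cptX])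
    have "continuous_on UNIV (\<lambda>p :: (nat \<Rightarrow> 'a) \<times> (nat \<Rightarrow> 'a). f (fst p))"
      by (rule continuous_on_compose2[OF f]) (simp_all add: continuous_intros)
    from continuous_on_mult[OF continuous_on_ratio(1)[OF h(1), of k] this]
    show "continuous_on UNIV (\<lambda>(x, y). h (x k - y k) * f x)"
      by (simp add: case_prod_beta')
  qed simp_all
  also have "\<dots> = (\<integral>y. I y \<partial>P')"
    by (simp add: I)
  finally have 1: "(\<integral>x. (\<integral>y. h (x k - y k) \<partial>P') * f x \<partial>P) = (\<integral>y. I y \<partial>P')" .
  have 2: "(\<integral>y. \<phi> y * g y \<partial>P') = (\<integral>y. \<phi> y * ?g y \<partial>P')"
    by (intro integral_mult_resample[OF cpt \<mu> P'] \<phi>_cont g) (simp add: \<phi>_def)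
  have pointwise: "\<bar>h (x k - y k) * (?f x - ?g y)\<bar> \<le> h (x k - y k) * e" for x y
  proof (cases "h (x k - y k) = 0")
    case False
    have "\<bar>?f x - ?g y\<bar> \<le> e"
      by (rule resample_close[OF cpt \<mu> f g, where w = "x k - y k"]) (auto intro: close[OF False])
    then show ?thesis
      by (simp add: abs_mult h(2) mult_left_mono)
  qed simp
  have inner: "\<bar>I y - \<phi> y * ?g y\<bar> \<le> e * \<phi> y" for y
  proof -
    have int: "integrable P (\<lambda>x. h (x k - y k) * ?f x)" "integrable P (\<lambda>x. h (x k - y k) * r)" for r
      by (intro intP continuous_on_mult continuous_on_ratio(3)[OF h(1)] cf continuous_on_const)+
    have "I y - \<phi> y * ?g y = (\<integral>x. h (x k - y k) * (?f x - ?g y) \<partial>P)"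
      unfolding I_def \<phi>_def using int by (simp add: right_diff_distrib)
    also have "\<bar>\<dots>\<bar> \<le> (\<integral>x. \<bar>h (x k - y k) * (?f x - ?g y)\<bar> \<partial>P)"
      by (rule integral_abs_bound)
    also have "\<dots> \<le> (\<integral>x. h (x k - y k) * e \<partial>P)"
      using int by (intro integral_mono pointwise) (auto simp: right_diff_distrib)
    also have "\<dots> = e * \<phi> y"
      by (simp add: \<phi>_def)
    finally show ?thesis .
  qed
  have int: "integrable P' I" "integrable P' (\<lambda>y. \<phi> y * ?g y)" "integrable P' \<phi>"
    by (intro intP' continuous_on_mult I_cont \<phi>_cont cg)+
  have "\<bar>(\<integral>y. I y \<partial>P') - (\<integral>y. \<phi> y * ?g y \<partial>P')\<bar> = \<bar>\<integral>y. I y - \<phi> y * ?g y \<partial>P'\<bar>"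
    using int by simp
  also have "\<dots> \<le> (\<integral>y. \<bar>I y - \<phi> y * ?g y\<bar> \<partial>P')"
    by (rule integral_abs_bound)
  also have "\<dots> \<le> (\<integral>y. e * \<phi> y \<partial>P')"
    using int by (intro integral_mono inner) auto
  also have "\<dots> = e * (\<integral>y. \<phi> y \<partial>P')"
    by simp
  finally show ?thesis
    unfolding 1 using 2 by (simp add: \<phi>_def)
qed

text \<open>
  The functional \<open>c k h\<close> is the expectation of \<open>h\<close> at the ratio of the two states at time \<open>-k\<close>, and
  \<open>z\<close> is a point that these ratios keep approaching. Let \<open>h\<close> be concentrated near \<open>z\<close>. Weighted
  with \<open>h\<close> of the ratio, the expectations of \<open>f\<close> under \<open>P\<close> and of its translate \<open>fz\<close> under \<open>P'\<close> are
  close by \<open>common_noise_estimate\<close>; by mixing, the weight asymptotically only contributes the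
  factor \<open>c k h\<close>, which does not tend to zero. So the two expectations agree.
\<close>

lemma extremal_solutions_transitive:
  fixes \<mu> :: "nat \<Rightarrow> 'a::{topological_group_add, t2_space} measure"
  assumes cpt: "compact (UNIV :: 'a set)"
    and \<mu>: "\<And>n. prob_space (\<mu> n)" "\<And>n. sets (\<mu> n) = sets borel"
    and P: "P \<in> extremal_solutions \<mu>" and P': "P' \<in> extremal_solutions \<mu>"
  shows "\<exists>z. P = translate z P'"
proof -
  have sol: "P \<in> solutions \<mu>" "P' \<in> solutions \<mu>"
    using P P' by (auto simp: extremal_solutions_def)
  note reg = solutionsD(1)[OF sol(1)] and reg' = solutionsD(1)[OF sol(2)]
  note [simp] = regular_probD[OF reg] regular_probD[OF reg']
  interpret P: prob_space P by simp
  interpret P': prob_space P' by simp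
  have cptX: "compact (UNIV :: (nat \<Rightarrow> 'a) set)"
    by (rule compact_UNIV_fun) fact
  have intP: "integrable P g" and intP': "integrable P' g" if "continuous_on UNIV g" for g :: "_ \<Rightarrow> real"
    by (intro continuous_integrable[OF cptX that]; simp add: P.finite_measure_axioms P'.finite_measure_axioms)+
  define \<phi> where "\<phi> h k y = (\<integral>x. h (x k - y k) \<partial>P)" for h :: "'a \<Rightarrow> real" and k and y :: "nat \<Rightarrow> 'a"
  define \<psi> where "\<psi> h k x = (\<integral>y. h (x k - y k) \<partial>P')" for h :: "'a \<Rightarrow> real" and k and x :: "nat \<Rightarrow> 'a"
  define c where "c k h = (\<integral>y. \<phi> h k y \<partial>P')" for k h
  have \<phi>_cont: "continuous_on UNIV (\<phi> h k)" if "continuous_on UNIV h" for h k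
    unfolding \<phi>_def[abs_def]
    by (rule continuous_on_integral_parameter[OF cptX continuous_on_ratio(2)[OF that]]) simp_all
  obtain z where z: "\<And>h. continuous_on UNIV h \<Longrightarrow> (\<And>x. 0 \<le> h x) \<Longrightarrow> 0 < h z \<Longrightarrow> \<not> (\<lambda>k. c k h) \<longlonglongrightarrow> 0"
  proof (rule support_point[OF cpt, of c])
    show "c k (\<lambda>x. \<Sum>z\<in>S. h z x) = (\<Sum>z\<in>S. c k (h z))"
      if "finite S" "\<And>z. z \<in> S \<Longrightarrow> continuous_on UNIV (h z)" for k S and h :: "'a \<Rightarrow> 'a \<Rightarrow> real"
    proof -
      have "\<phi> (\<lambda>x. \<Sum>z\<in>S. h z x) k y = (\<Sum>z\<in>S. \<phi> (h z) k y)" for y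
        unfolding \<phi>_def using that
        by (intro Bochner_Integration.integral_sum intP continuous_on_ratio(3)) auto
      then have "c k (\<lambda>x. \<Sum>z\<in>S. h z x) = (\<integral>y. (\<Sum>z\<in>S. \<phi> (h z) k y) \<partial>P')"
        unfolding c_def by (intro Bochner_Integration.integral_cong refl)
      also have "\<dots> = (\<Sum>z\<in>S. c k (h z))"
        unfolding c_def using that by (intro Bochner_Integration.integral_sum intP' \<phi>_cont) auto
      finally show ?thesis .
    qed
    show "d \<le> c k h" if h: "continuous_on UNIV h" "\<And>x. d \<le> h x" for k h d
    proof -
      have "(\<integral>x. d \<partial>P) \<le> \<phi> h k y" for y
        unfolding \<phi>_def using h by (intro integral_mono intP continuous_on_ratio(3)) auto
      then have "d \<le> \<phi> h k y" for y
        using P.prob_space by simp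
      then have "(\<integral>y. d \<partial>P') \<le> c k h"
        unfolding c_def using h by (intro integral_mono intP' \<phi>_cont) auto
      then show ?thesis
        using P'.prob_space by simp
    qed
  qed blast
  have "P = translate z P'"
  proof (rule regular_prob_eqI[OF cptX reg regular_prob_translate[OF reg']])
    fix f :: "(nat \<Rightarrow> 'a) \<Rightarrow> real" assume f: "continuous_on UNIV f"
    define fz where "fz y = f (\<lambda>n. z + y n)" for y
    have fz: "continuous_on UNIV fz"
      unfolding fz_def[abs_def] by (rule continuous_on_compose2[OF f continuous_on_translate_path]) simp
    define D where "D = (\<integral>x. f x \<partial>P) - (\<integral>y. fz y \<partial>P')"
    have "D = 0"
    proof (rule ccontr)
      assume "D \<noteq> 0"
      \<comment> \<open>Of the margin \<open>4 * e\<close>, the common noise estimate uses up \<open>2 * e\<close>: one \<open>e\<close> for the truncation to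
        finitely many coordinates and one for the variation of the ratio near \<open>z\<close>.\<close>
      define e where "e = \<bar>D\<bar> / 4"
      have "0 < e"
        using \<open>D \<noteq> 0\<close> by (simp add: e_def)
      obtain n where n: "\<And>x y. (\<And>j. j \<le> n \<Longrightarrow> x j = y j) \<Longrightarrow> \<bar>f x - f y\<bar> \<le> e"
        using continuous_depends_on_finitely_many[OF cpt f \<open>0 < e\<close>] by blast
      have fT: "continuous_on UNIV (\<lambda>(g, x). f (\<lambda>n. g + x n))"
        using continuous_on_compose2[OF f continuous_on_translation] by (simp add: case_prod_beta')
      obtain A where A: "open A" "z \<in> A"
        "\<And>g x. g \<in> A \<Longrightarrow> \<bar>f (\<lambda>n. g + x n) - f (\<lambda>n. z + x n)\<bar> \<le> e"
        by (rule uniform_in_compact_parameter[OF cptX fT \<open>0 < e\<close>, where z = z]) blast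
      obtain h :: "'a \<Rightarrow> real" where h: "continuous_on UNIV h" "range h \<subseteq> {0..1}"
        "\<And>x. x \<in> - A \<Longrightarrow> h x = 0" "\<And>x. x \<in> {z} \<Longrightarrow> h x = 1"
        by (rule Urysohn_compact[OF cpt, of "- A" "{z}"]) (use A in auto)
      have h01: "0 \<le> h x" "h x \<le> 1" for x
        using h(2) by (auto simp: image_subset_iff)
      have hd: "continuous_on UNIV (\<lambda>(s, t). h (s - t))" "continuous_on UNIV (\<lambda>(s, t). h (t - s))"
        unfolding case_prod_beta' by (intro continuous_on_compose2[OF h(1)] continuous_intros; simp)+
      have c_eq: "(\<integral>x. \<psi> h k x \<partial>P) = c k h" for k
        unfolding \<psi>_def c_def \<phi>_def
        by (rule Fubini_continuous[OF cptX cptX continuous_on_ratio(1)[OF h(1)]]) simp_all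
      let ?a = "\<lambda>k. (\<integral>x. \<psi> h k x * f x \<partial>P) - c k h * (\<integral>x. f x \<partial>P)"
      let ?b = "\<lambda>k. (\<integral>y. \<phi> h k y * fz y \<partial>P') - c k h * (\<integral>y. fz y \<partial>P')"
      have "(\<lambda>k. (\<integral>x. \<psi> h k x * f x \<partial>P) - (\<integral>x. \<psi> h k x \<partial>P) * (\<integral>x. f x \<partial>P)) \<longlonglongrightarrow> 0"
        using averaged_weight[OF cpt hd(1) h01 reg'] unfolding \<psi>_def
        by (intro extremal_remote_past_mixing[OF \<mu> P] intP f) auto
      then have mixP: "?a \<longlonglongrightarrow> 0"
        unfolding c_eq .
      have "(\<lambda>k. (\<integral>y. \<phi> h k y * fz y \<partial>P') - (\<integral>y. \<phi> h k y \<partial>P') * (\<integral>y. fz y \<partial>P')) \<longlonglongrightarrow> 0"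
        using averaged_weight[OF cpt hd(2) h01 reg] unfolding \<phi>_def
        by (intro extremal_remote_past_mixing[OF \<mu> P'] intP' fz) auto
      then have mixP': "?b \<longlonglongrightarrow> 0"
        unfolding c_def .
      have c_nonneg: "0 \<le> c k h" for k
        unfolding c_def \<phi>_def by (intro integral_nonneg_AE AE_I2) (simp add: h01)
      have close: "\<bar>(\<integral>x. \<psi> h k x * f x \<partial>P) - (\<integral>y. \<phi> h k y * fz y \<partial>P')\<bar> \<le> 2 * e * c k h"
        if "n \<le> k" for k
        unfolding \<psi>_def \<phi>_def c_def
      proof (rule common_noise_estimate[OF cpt \<mu> sol h(1) h01(1) f fz])
        fix w and x y :: "nat \<Rightarrow> 'a"
        assume "h w \<noteq> 0" and shift: "\<And>j. j \<le> k \<Longrightarrow> x j = w + y j"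
        then have "w \<in> A"
          using h(3) by auto
        then have "\<bar>f (\<lambda>n. w + y n) - fz y\<bar> \<le> e"
          unfolding fz_def by (rule A(3))
        moreover have "\<bar>f x - f (\<lambda>n. w + y n)\<bar> \<le> e"
          using that by (intro n shift) simp
        ultimately show "\<bar>f x - fz y\<bar> \<le> 2 * e"
          by linarith
      qed
      have "(\<lambda>k. c k h) \<longlonglongrightarrow> 0"
      proof (rule tendsto_sandwich[OF _ _ tendsto_const])
        show "eventually (\<lambda>k. 0 \<le> c k h) sequentially"
          using c_nonneg by simp
        have "(\<lambda>k. (\<bar>?a k\<bar> + \<bar>?b k\<bar>) / (2 * e)) \<longlonglongrightarrow> (\<bar>0\<bar> + \<bar>0\<bar>) / (2 * e)"
          by (intro tendsto_intros mixP mixP') (use \<open>0 < e\<close> in simp)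
        then show "(\<lambda>k. (\<bar>?a k\<bar> + \<bar>?b k\<bar>) / (2 * e)) \<longlonglongrightarrow> 0"
          by simp
        show "eventually (\<lambda>k. c k h \<le> (\<bar>?a k\<bar> + \<bar>?b k\<bar>) / (2 * e)) sequentially"
          using eventually_ge_at_top[of n]
        proof eventually_elim
          case (elim k)
          have "c k h * D = (\<integral>x. \<psi> h k x * f x \<partial>P) - (\<integral>y. \<phi> h k y * fz y \<partial>P') - ?a k + ?b k"
            by (simp add: D_def algebra_simps)
          then have "\<bar>c k h * D\<bar> \<le> 2 * e * c k h + \<bar>?a k\<bar> + \<bar>?b k\<bar>"
            using close[OF elim] by linarith
          moreover have "\<bar>c k h * D\<bar> = 4 * e * c k h"
            using c_nonneg[of k] by (simp add: e_def abs_mult)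
          ultimately show ?case
            using \<open>0 < e\<close> by (simp add: field_simps)
        qed
      qed
      then show False
        using z[of h] h by (simp add: h01)
    qed
    then show "(\<integral>x. f x \<partial>P) = (\<integral>x. f x \<partial>translate z P')"
      using integral_translate[OF f, of P' z] by (simp add: D_def fz_def)
  qed
  then show ?thesis ..
qed

section \<open>The homeomorphism\<close>

text \<open>
  Regular measures are separated by the integrals of continuous functions.
\<close>

lemma Hausdorff_weak_star_topology:
  assumes cpt: "compact (UNIV :: 'b::t2_space set)"
  shows "Hausdorff_space (weak_star_topology :: 'b measure topology)"
  unfolding Hausdorff_space_def topspace_weak_star_topology
proof (intro allI impI, elim conjE)
  fix M N :: "'b measure"
  assume M: "M \<in> Collect regular_prob" and N: "N \<in> Collect regular_prob" and "M \<noteq> N"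
  then obtain f :: "'b \<Rightarrow> real" where f: "continuous_on UNIV f" "(\<integral>x. f x \<partial>M) \<noteq> (\<integral>x. f x \<partial>N)"
    using regular_prob_eqI[OF cpt, of M N] by auto
  obtain U V where UV: "open U" "open V" "(\<integral>x. f x \<partial>M) \<in> U" "(\<integral>x. f x \<partial>N) \<in> V" "U \<inter> V = {}"
    using hausdorff[OF f(2)] by blast
  define B where "B W = {L. regular_prob L \<and> (\<integral>x. f x \<partial>L) \<in> W}" for W
  have "openin weak_star_topology (B W)" if "open W" for W
    unfolding weak_star_topology_def
    by (rule topology_generated_by_Basis) (use f(1) that B_def in blast)
  moreover have "M \<in> B U" "N \<in> B V" "disjnt (B U) (B V)"
    using UV M N by (auto simp: B_def disjnt_def)
  ultimately show "\<exists>S T. openin weak_star_topology S \<and> openin weak_star_topology T \<and>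
      M \<in> S \<and> N \<in> T \<and> disjnt S T"
    using UV by blast
qed

lemma continuous_map_translate:
  fixes P :: "(nat \<Rightarrow> 'a::{topological_group_add, t2_space}) measure"
  assumes cpt: "compact (UNIV :: 'a set)" and P: "regular_prob P"
  shows "continuous_map euclidean weak_star_topology (\<lambda>g. translate g P)"
  unfolding weak_star_topology_def
proof (rule continuous_on_generated_topo)
  have cptX: "compact (UNIV :: (nat \<Rightarrow> 'a) set)"
    by (rule compact_UNIV_fun) fact
  fix S :: "(nat \<Rightarrow> 'a) measure set"
  assume "S \<in> {{M. regular_prob M \<and> (\<integral>x. f x \<partial>M) \<in> U} | (f :: (nat \<Rightarrow> 'a) \<Rightarrow> real) U.
      continuous_on UNIV f \<and> open U}"
  then obtain f :: "(nat \<Rightarrow> 'a) \<Rightarrow> real" and U where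
    f: "continuous_on UNIV f" and U: "open U" and S: "S = {M. regular_prob M \<and> (\<integral>x. f x \<partial>M) \<in> U}"
    by blast
  have "continuous_on UNIV (\<lambda>(g, x). f (\<lambda>n. g + x n))"
    using continuous_on_compose2[OF f continuous_on_translation] by (simp add: case_prod_beta')
  then have "continuous_on UNIV (\<lambda>g. \<integral>x. f (\<lambda>n. g + x n) \<partial>P)"
    by (rule continuous_on_integral_parameter[OF cptX]) (use regular_probD[OF P] in auto)
  then have "open ((\<lambda>g. \<integral>x. f (\<lambda>n. g + x n) \<partial>P) -` U)"
    by (rule open_vimage[OF U])
  moreover have "(\<lambda>g. translate g P) -` S = (\<lambda>g. \<integral>x. f (\<lambda>n. g + x n) \<partial>P) -` U"
    using regular_prob_translate[OF P] regular_probD(2)[OF P] by (auto simp: S integral_translate f)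
  ultimately show "openin euclidean ((\<lambda>g. translate g P) -` S \<inter> topspace euclidean)"
    by simp
next
  show "(\<lambda>g. translate g P) ` topspace euclidean \<subseteq>
      \<Union> {{M. regular_prob M \<and> (\<integral>x. f x \<partial>M) \<in> U} | (f :: (nat \<Rightarrow> 'a) \<Rightarrow> real) U.
        continuous_on UNIV f \<and> open U}"
    using regular_prob_translate[OF P] topspace_weak_star_topology[where 'a = "nat \<Rightarrow> 'a"]
    unfolding weak_star_topology_def topology_generated_by_topspace by auto
qed

lemma coset_isotropy_eq_iff:
  fixes P :: "(nat \<Rightarrow> 'a::topological_group_add) measure"
  assumes P: "sets P = sets borel"
  shows "g +o isotropy P = g' +o isotropy P \<longleftrightarrow> translate g P = translate g' P"
proof
  assume eq: "g +o isotropy P = g' +o isotropy P"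
  \<comment> \<open>The unit of the group lies in the isotropy group.\<close>
  have "g \<in> g +o isotropy P"
    using translate_0[OF P] by (auto simp: elt_set_plus_def isotropy_def intro!: exI[of _ 0])
  then obtain h where "translate h P = P" "g = g' + h"
    unfolding eq by (auto simp: elt_set_plus_def isotropy_def)
  then show "translate g P = translate g' P"
    using translate_translate[OF P, of g' h] by simp
next
  have sub: "g +o isotropy P \<subseteq> g' +o isotropy P" if eq: "translate g P = translate g' P" for g g'
  proof
    fix a assume "a \<in> g +o isotropy P"
    then obtain h where h: "translate h P = P" "a = g + h"
      by (auto simp: elt_set_plus_def isotropy_def)
    have "translate (- g' + a) P = translate (- g') (translate g (translate h P))"
      by (simp add: translate_translate P h(2))
    also have "\<dots> = P"
      using translate_eq_iff[OF P, of "translate g P" g'] eq by (simp add: h(1))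
    finally show "a \<in> g' +o isotropy P"
      by (auto simp: elt_set_plus_def isotropy_def add.assoc[symmetric] intro!: bexI[of _ "- g' + a"])
  qed
  assume "translate g P = translate g' P"
  then show "g +o isotropy P = g' +o isotropy P"
    using sub[of g g'] sub[of g' g] by (intro equalityI) simp_all
qed

theorem corollary4p4:
  fixes \<mu> :: "nat \<Rightarrow> 'a::{topological_group_add, t2_space} measure"
    and P\<^sub>0 :: "(nat \<Rightarrow> 'a) measure"
  assumes compact_group: "compact (UNIV :: 'a set)"
    and nontrivial: "(UNIV :: 'a set) \<noteq> {0}"
    and noise_law: "\<And>n. prob_space (\<mu> n)" "\<And>n. sets (\<mu> n) = sets borel"
    and extremal: "P\<^sub>0 \<in> extremal_solutions \<mu>"
  shows "\<exists>\<Phi>. (\<forall>g. \<Phi> (g +o isotropy P\<^sub>0) = translate g P\<^sub>0) \<and>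
    homeomorphic_map (coset_topology (isotropy P\<^sub>0))
      (subtopology weak_star_topology (extremal_solutions \<mu>)) \<Phi>"
proof -
  have reg: "regular_prob P\<^sub>0"
    using extremal by (simp add: extremal_solutions_def solutions_def)
  note sets = regular_probD(2)[OF reg]
  define \<Phi> where "\<Phi> C = translate (SOME g. g +o isotropy P\<^sub>0 = C) P\<^sub>0" for C
  have \<Phi>: "\<Phi> (g +o isotropy P\<^sub>0) = translate g P\<^sub>0" for g
    unfolding \<Phi>_def using coset_isotropy_eq_iff[OF sets]
    by (metis (mono_tags, lifting) someI_ex)
  have orbit: "range (\<lambda>g. translate g P\<^sub>0) = extremal_solutions \<mu>"
    using translate_extremal[OF noise_law extremal]
      extremal_solutions_transitive[OF compact_group noise_law _ extremal] by blast
  have "homeomorphic_map (coset_topology (isotropy P\<^sub>0))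
      (subtopology weak_star_topology (extremal_solutions \<mu>)) \<Phi>"
  proof (rule continuous_imp_homeomorphic_map)
    have "continuous_map euclidean weak_star_topology (\<Phi> \<circ> (\<lambda>g. g +o isotropy P\<^sub>0))"
      using continuous_map_translate[OF compact_group reg] by (simp add: o_def \<Phi>)
    then have "continuous_map (coset_topology (isotropy P\<^sub>0)) weak_star_topology \<Phi>"
      by (rule continuous_compose_quotient_map[OF quotient_map_coset_topology])
    then show "continuous_map (coset_topology (isotropy P\<^sub>0))
        (subtopology weak_star_topology (extremal_solutions \<mu>)) \<Phi>"
      by (auto simp: continuous_map_in_subtopology topspace_coset_topology \<Phi> simp flip: orbit)
    show "compact_space (coset_topology (isotropy P\<^sub>0))"
      using image_compactin[OF _ quotient_imp_continuous_map[OF quotient_map_coset_topology], of UNIV]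
        compact_group by (simp add: compact_space_def topspace_coset_topology)
    show "Hausdorff_space (subtopology weak_star_topology (extremal_solutions \<mu>))"
      by (intro Hausdorff_space_subtopology Hausdorff_weak_star_topology compact_UNIV_fun compact_group)
    have "extremal_solutions \<mu> \<subseteq> Collect regular_prob"
      by (auto simp: extremal_solutions_def solutions_def)
    then show "\<Phi> ` topspace (coset_topology (isotropy P\<^sub>0)) =
        topspace (subtopology weak_star_topology (extremal_solutions \<mu>))"
      by (simp add: topspace_coset_topology topspace_weak_star_topology image_image \<Phi> orbit
          Int_absorb1)
    show "inj_on \<Phi> (topspace (coset_topology (isotropy P\<^sub>0)))"
      by (auto simp: topspace_coset_topology inj_on_def \<Phi> coset_isotropy_eq_iff[OF sets])
  qed
  with \<Phi> show ?thesis by blast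
qed

end
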